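(* Let $N\ge1$ be an integer and let $\mathcal H^{\rm A},\mathcal H^{\rm B}$ be Hilbert spaces of dimension $N$ with orthonormal bases $\{|i\rangle^{\rm A}\}_{i=1}^N$ and $\{|i\rangle^{\rm B}\}_{i=1}^N$. Let $$|\Psi_{\rm Bell}\rangle=\frac1{\sqrt N}\sum_{i=1}^N|i\rangle^{\rm A}|i\rangle^{\rm B}$$ be the generalized Bell state vector. Then, among all density matrices on $\mathcal H^{\rm A}\otimes\mathcal H^{\rm B}$, $M$ takes its maximum value at $|\Psi_{\rm Bell}\rangle\langle\Psi_{\rm Bell}|$; that is, $M(\rho)\le M(|\Psi_{\rm Bell}\rangle\langle\Psi_{\rm Bell}|)$ for every density matrix $\rho$ on $\mathcal H^{\rm A}\otimes\mathcal H^{\rm B}$.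
   Context: A density matrix is a positive semidefinite Hermitian matrix of trace one. Definition of $M$ for a density matrix $\rho^{\rm AB}$ on a finite-dimensional $\mathcal H^{\rm A}\otimes\mathcal H^{\rm B}$. For $x,y\ge0$ let ${\rm nim}_y(x)$ be the nearest integer multiple of $y$ to $x$, ties rounded down: ${\rm nim}_0(x)=0$, and for $y\neq0$, ${\rm nim}_y(x)=y\lfloor x/y\rfloor$ if $x-y\lfloor x/y\rfloor\le y\lceil x/y\rceil-x$, and ${\rm nim}_y(x)=y\lceil x/y\rceil$ otherwise. Let $\eta_1,\dots,\eta_m$ be the distinct eigenvalues of $\rho^{\rm AB}$, let $d^{\eta_j}$ be the dimension of the $\eta_j$-eigenspace, and let $\tilde\rho^{\eta_j}$ be $\eta_j$ times the orthogonal projector onto the $\eta_j$-eigenspace, so $\rho^{\rm AB}=\sum_j\tilde\rho^{\eta_j}$. Let $\lambda_i^{j,{\rm A}}$, $i=1,\dots,d_j^{\rm A}$, be the nonzero eigenvalues, with multiplicity, of ${\rm Tr}_{\rm B}\tilde\rho^{\eta_j}$, where $d_j^{\rm A}$ is its rank (an eigenvalue $\eta_j=0$ contributes an empty sum). Define $$M^{\rm A}(\rho^{\rm AB})=-\sum_{j=1}^m\sum_{i=1}^{d_j^{\rm A}}\left|\lambda_i^{j,{\rm A}}-{\rm nim}_{\eta_j}(\lambda_i^{j,{\rm A}})\right|\log_2\frac{\lambda_i^{j,{\rm A}}}{\eta_jd^{\eta_j}}.$$ $M^{\rm B}(\rho^{\rm AB})$ is defined in the same way using the nonzero eigenvalues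 $\lambda_i^{j,{\rm B}}$ of ${\rm Tr}_{\rm A}\tilde\rho^{\eta_j}$. Finally $M(\rho^{\rm AB})=\frac12[M^{\rm A}(\rho^{\rm AB})+M^{\rm B}(\rho^{\rm AB})]$. *)

theory Defs
  imports
    Complex_Main
    "HOL-Computational_Algebra.Polynomial"
    "Jordan_Normal_Form.Matrix_Kernel"
    "Jordan_Normal_Form.Schur_Decomposition"
begin

definition density_matrix :: "nat \<Rightarrow> complex mat \<Rightarrow> bool" where
  "density_matrix n \<rho> \<longleftrightarrow>
     \<rho> \<in> carrier_mat n n \<and>
     mat_adjoint \<rho> = \<rho> \<and>
     (\<forall>v\<in>carrier_vec n. 0 \<le> Re ((\<rho> *\<^sub>v v) \<bullet>c v)) \<and>
     (\<Sum>i<n. \<rho> $$ (i, i)) = 1"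

(* Ties are rounded down. *)
definition nim :: "real \<Rightarrow> real \<Rightarrow> real" where
  "nim y x =
     (if y = 0 then 0
      else if x - y * of_int \<lfloor>x / y\<rfloor> \<le> y * of_int \<lceil>x / y\<rceil> - x
           then y * of_int \<lfloor>x / y\<rfloor>
           else y * of_int \<lceil>x / y\<rceil>)"

definition eigenspace :: "complex mat \<Rightarrow> complex \<Rightarrow> complex vec set" where
  "eigenspace A e = mat_kernel (char_matrix A e)"

definition eigenspace_dim :: "complex mat \<Rightarrow> complex \<Rightarrow> nat" where
  "eigenspace_dim A e = kernel_dim (char_matrix A e)"

definition is_orth_projector :: "nat \<Rightarrow> complex vec set \<Rightarrow> complex mat \<Rightarrow> bool" where
  "is_orth_projector n S P \<longleftrightarrow>
     P \<in> carrier_mat n n \<and> mat_adjoint P = P \<and> P * P = P \<and>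
     (\<lambda>v. P *\<^sub>v v) ` carrier_vec n = S"

definition eigenprojector :: "complex mat \<Rightarrow> complex \<Rightarrow> complex mat" where
  "eigenprojector A e = (THE P. is_orth_projector (dim_row A) (eigenspace A e) P)"

(* The basis vector |i>|k> of the tensor product of spaces of dimensions dA and dB
   has index i * dB + k (with i < dA and k < dB). *)
definition tensor_vec :: "complex vec \<Rightarrow> complex vec \<Rightarrow> complex vec" where
  "tensor_vec u v =
     vec (dim_vec u * dim_vec v) (\<lambda>i. u $ (i div dim_vec v) * v $ (i mod dim_vec v))"

definition ptrace_B :: "nat \<Rightarrow> nat \<Rightarrow> complex mat \<Rightarrow> complex mat" where
  "ptrace_B dA dB X = mat dA dA (\<lambda>(i, j). \<Sum>k<dB. X $$ (i * dB + k, j * dB + k))"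

definition ptrace_A :: "nat \<Rightarrow> nat \<Rightarrow> complex mat \<Rightarrow> complex mat" where
  "ptrace_A dA dB X = mat dB dB (\<lambda>(k, l). \<Sum>i<dA. X $$ (i * dB + k, i * dB + l))"

(* The multiset of nonzero eigenvalues, with multiplicity; it is only used for Hermitian
   matrices, whose eigenvalues are real, so that Re loses nothing. *)
definition nonzero_eigenvalues :: "complex mat \<Rightarrow> real multiset" where
  "nonzero_eigenvalues X = image_mset Re (filter_mset (\<lambda>z. z \<noteq> 0) (proots (char_poly X)))"

(* The common form of M^A and M^B, for the partial trace ptr. The outer sum ranges over the
   distinct eigenvalues of the Hermitian matrix rho, which are all real. *)
definition M_marginal :: "(complex mat \<Rightarrow> complex mat) \<Rightarrow> complex mat \<Rightarrow> real" where
  "M_marginal ptr \<rho> =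
     - (\<Sum>\<eta> | eigenvalue \<rho> (complex_of_real \<eta>).
          \<Sum>x \<in># nonzero_eigenvalues
                    (ptr (complex_of_real \<eta> \<cdot>\<^sub>m eigenprojector \<rho> (complex_of_real \<eta>))).
            \<bar>x - nim \<eta> x\<bar> *
            log 2 (x / (\<eta> * real (eigenspace_dim \<rho> (complex_of_real \<eta>)))))"

definition M_A :: "nat \<Rightarrow> nat \<Rightarrow> complex mat \<Rightarrow> real" where
  "M_A dA dB \<rho> = M_marginal (ptrace_B dA dB) \<rho>"

definition M_B :: "nat \<Rightarrow> nat \<Rightarrow> complex mat \<Rightarrow> real" where
  "M_B dA dB \<rho> = M_marginal (ptrace_A dA dB) \<rho>"

definition M_AB :: "nat \<Rightarrow> nat \<Rightarrow> complex mat \<Rightarrow> real" where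
  "M_AB dA dB \<rho> = (M_A dA dB \<rho> + M_B dA dB \<rho>) / 2"

(* In dimension n, an orthonormal family indexed by {..<n} is automatically a basis. *)
definition orthonormal_basis :: "nat \<Rightarrow> (nat \<Rightarrow> complex vec) \<Rightarrow> bool" where
  "orthonormal_basis n a \<longleftrightarrow>
     (\<forall>i<n. a i \<in> carrier_vec n) \<and>
     (\<forall>i<n. \<forall>j<n. a i \<bullet>c a j = (if i = j then 1 else 0))"

definition bell_vec :: "nat \<Rightarrow> (nat \<Rightarrow> complex vec) \<Rightarrow> (nat \<Rightarrow> complex vec) \<Rightarrow> complex vec" where
  "bell_vec N a b =
     complex_of_real (1 / sqrt (real N)) \<cdot>\<^sub>v
       finsum_vec TYPE(complex) (N * N) (\<lambda>i. tensor_vec (a i) (b i)) {..<N}"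

definition pure_state :: "complex vec \<Rightarrow> complex mat" where
  "pure_state \<psi> = mat (dim_vec \<psi>) (dim_vec \<psi>) (\<lambda>(i, j). \<psi> $ i * cnj (\<psi> $ j))"

end

(* Write p_j for eta_j times the multiplicity of eta_j. The p_j sum to 1, and the nonzero
   eigenvalues x_i of the marginal of the eta_j-block sum to p_j, since the partial trace
   preserves traces. As 0 is a multiple of eta_j, |x_i - nim(x_i)| <= x_i, so the eta_j-term of M^A
   is at most the sum of x_i log(p_j / x_i), which is p_j times the entropy of a distribution on at
   most N points, hence at most p_j log N. Summing over j gives M <= log N. The Bell state attains
   this value: both its marginals are I/N, and nim_1(1/N) = 0 for N >= 2. *)
theory Submission
  imports Defs "Jordan_Normal_Form.Jordan_Normal_Form_Uniqueness"
begin

section \<open>Unitary diagonalization of Hermitian matrices\<close>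

text \<open>The ingredients of M are given abstractly: the projector by a definite description, the
  multiplicity as a kernel dimension, the spectrum as roots of a characteristic polynomial. A
  unitary diagonalization ties them together, since all three can be read off from it; this is why
  the spectral theorem is needed. Replacing the weight |x_i - nim(x_i)| by x_i takes two signs: x_i
  >= 0, for the weight estimate itself, and log(x_i / p_j) <= 0, for multiplying it by the
  logarithm. Both come from the positivity of the partial trace, so the bound is proved for any
  positive trace-preserving map and applied to the two marginals. The eigenvalue 0 needs no separate
  treatment in the bound: its block has p_j = 0 and only vanishing x_i. For N = 1 the Bell term has
  weight 0, since 1 is a multiple of 1, but log N = 0 as well.\<close>

lemma dim_mat_adjoint [simp]:
  "dim_row (mat_adjoint A) = dim_col A" "dim_col (mat_adjoint A) = dim_row A"
  by (simp_all add: mat_adjoint_def)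

lemma index_mat_adjoint [simp]:
  assumes "i < dim_col A" "j < dim_row A"
  shows "mat_adjoint A $$ (i, j) = conjugate (A $$ (j, i))"
  using assms by (simp add: mat_adjoint_def mat_of_rows_index)

lemma mat_adjoint_carrier [simp]:
  "A \<in> carrier_mat n m \<Longrightarrow> mat_adjoint A \<in> carrier_mat m n"
  by auto

lemma mat_adjoint_mat_adjoint [simp]: "mat_adjoint (mat_adjoint A) = A"
  by (rule eq_matI) auto

lemma mat_adjoint_mult:
  fixes A B :: "complex mat"
  assumes "A \<in> carrier_mat n m" "B \<in> carrier_mat m k"
  shows "mat_adjoint (A * B) = mat_adjoint B * mat_adjoint A"
  by (rule eq_matI) (use assms in \<open>auto simp: scalar_prod_def mult.commute\<close>)

lemma mat_adjoint_one [simp]: "mat_adjoint (1\<^sub>m n :: complex mat) = 1\<^sub>m n"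
  by (rule eq_matI) auto

lemma mat_adjoint_mat_diag: "mat_adjoint (mat_diag n d :: complex mat) = mat_diag n (\<lambda>i. cnj (d i))"
  by (rule eq_matI) (auto simp: mat_diag_def)

lemma mat_adjoint_smult: "mat_adjoint (c \<cdot>\<^sub>m A :: complex mat) = cnj c \<cdot>\<^sub>m mat_adjoint A"
  by (rule eq_matI) auto

lemma mat_adjoint_four_block_diag:
  fixes A B :: "complex mat"
  assumes "A \<in> carrier_mat n n" "B \<in> carrier_mat m m"
  shows "mat_adjoint (four_block_mat A (0\<^sub>m n m) (0\<^sub>m m n) B) =
    four_block_mat (mat_adjoint A) (0\<^sub>m n m) (0\<^sub>m m n) (mat_adjoint B)"
  by (rule eq_matI) (use assms in auto)

lemma hermitian_index:
  fixes A :: "complex mat"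
  assumes "A \<in> carrier_mat n n" "mat_adjoint A = A" "i < n" "j < n"
  shows "cnj (A $$ (i, j)) = A $$ (j, i)"
  using assms index_mat_adjoint[of j A i] by auto

lemma cscalar_prod_mat_adjoint:
  fixes A :: "complex mat"
  assumes "A \<in> carrier_mat n m" "v \<in> carrier_vec m" "w \<in> carrier_vec n"
  shows "(A *\<^sub>v v) \<bullet>c w = v \<bullet>c (mat_adjoint A *\<^sub>v w)"
proof -
  have "(A *\<^sub>v v) \<bullet>c w = (\<Sum>i<n. \<Sum>j<m. A $$ (i, j) * v $ j * cnj (w $ i))"
    using assms by (auto simp: scalar_prod_def sum_distrib_right atLeast0LessThan intro!: sum.cong)
  also have "\<dots> = (\<Sum>j<m. \<Sum>i<n. A $$ (i, j) * v $ j * cnj (w $ i))"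
    by (rule sum.swap)
  also have "\<dots> = v \<bullet>c (mat_adjoint A *\<^sub>v w)"
    using assms by (auto simp: scalar_prod_def sum_distrib_left atLeast0LessThan ac_simps intro!: sum.cong)
  finally show ?thesis .
qed

text \<open>Complete \<open>v\<close> to a basis and orthogonalize by Gram-Schmidt, which leaves the
  first vector unchanged; the normalized vectors are the columns of \<open>W\<close>. The factor
  \<open>c\<close> stays unspecified because a multiple of an eigenvector serves equally
  well.\<close>

lemma unitary_with_first_column:
  fixes v :: "complex vec"
  assumes v: "v \<in> carrier_vec n" and v0: "v \<noteq> 0\<^sub>v n"
  obtains W c where "W \<in> carrier_mat n n" "mat_adjoint W * W = 1\<^sub>m n" "col W 0 = c \<cdot>\<^sub>v v"
proof -
  interpret cof_vec_space n "TYPE(complex)" .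
  have n: "n \<noteq> 0" using v v0 by (metis carrier_vec_dim_vec eq_vecI index_zero_vec(2) carrier_vecD not_less0)
  define b where "b = basis_completion v"
  define ws where "ws = gram_schmidt n b"
  from basis_completion[OF v v0, folded b_def]
  have dist_b: "distinct b" and indep: "\<not> lin_dep (set b)" and b: "set b \<subseteq> carrier_vec n"
    and hdb: "hd b = v" and len_b: "length b = n" by auto
  from hdb len_b n obtain vs where bv: "b = v # vs" by (cases b) auto
  from gram_schmidt_result[OF b dist_b indep refl, folded ws_def]
  have ws: "set ws \<subseteq> carrier_vec n" "corthogonal ws" "length ws = n"
    by (auto simp: len_b)
  from gram_schmidt_hd[OF v, of vs, folded bv] have "hd ws = v" unfolding ws_def .
  with ws n have ws0: "ws ! 0 = v" by (metis hd_conv_nth list.size(3))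
  have wsc: "ws ! j \<in> carrier_vec n" if "j < n" for j using ws that by auto
  \<comment> \<open>The reciprocal norm of \<open>ws ! j\<close>. The inner product of a vector with
    itself is a complex number with vanishing imaginary part, hence the \<open>Re\<close>.\<close>
  define s where "s j = complex_of_real (1 / sqrt (Re (ws ! j \<bullet>c ws ! j)))" for j
  define W where "W = mat n n (\<lambda>(i, j). s j * ws ! j $ i)"
  have W: "W \<in> carrier_mat n n" by (simp add: W_def)
  have adj: "(mat_adjoint W * W) $$ (i, j) = cnj (s i) * s j * (ws ! j \<bullet>c ws ! i)"
    if "i < n" "j < n" for i j
    using that wsc[OF that(1)] wsc[OF that(2)]
    by (simp add: W_def scalar_prod_def sum_distrib_left ac_simps)
  have ss: "cnj (s i) * s i * (ws ! i \<bullet>c ws ! i) = 1" if "i < n" for i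
  proof -
    have "ws ! i \<bullet>c ws ! i \<ge> 0" by (rule conjugate_square_ge_0_vec)
    moreover have "ws ! i \<bullet>c ws ! i \<noteq> 0" using corthogonalD[OF ws(2), of i i] ws(3) that by auto
    ultimately have "Re (ws ! i \<bullet>c ws ! i) > 0" "ws ! i \<bullet>c ws ! i = of_real (Re (ws ! i \<bullet>c ws ! i))"
      by (auto simp: less_eq_complex_def complex_eq_iff)
    then obtain r where r: "r > 0" "ws ! i \<bullet>c ws ! i = complex_of_real r" by auto
    then have "cnj (s i) * s i * (ws ! i \<bullet>c ws ! i) = of_real (1 / sqrt r * (1 / sqrt r) * r)"
      by (simp add: s_def flip: of_real_mult)
    also have "1 / sqrt r * (1 / sqrt r) * r = 1"
      using r by (simp add: field_simps)
    finally show ?thesis by simp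
  qed
  have "mat_adjoint W * W = 1\<^sub>m n"
  proof (rule eq_matI)
    fix i j assume "i < dim_row (1\<^sub>m n :: complex mat)" "j < dim_col (1\<^sub>m n :: complex mat)"
    then have ij: "i < n" "j < n" by auto
    show "(mat_adjoint W * W) $$ (i, j) = 1\<^sub>m n $$ (i, j)"
    proof (cases "i = j")
      case True then show ?thesis using ss ij adj by simp
    next
      case False
      then have "ws ! j \<bullet>c ws ! i = 0" using corthogonalD[OF ws(2), of j i] ws(3) ij by auto
      then show ?thesis using False ij adj by simp
    qed
  qed (use W in auto)
  moreover have "col W 0 = s 0 \<cdot>\<^sub>v v"
    by (rule eq_vecI) (use n v ws0 in \<open>auto simp: W_def\<close>)
  ultimately show thesis using that W by blast
qed

lemma unitary_right_inverse:
  fixes U :: "complex mat"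
  assumes "U \<in> carrier_mat n n" "mat_adjoint U * U = 1\<^sub>m n"
  shows "U * mat_adjoint U = 1\<^sub>m n"
  using mat_mult_left_right_inverse[of "mat_adjoint U" n U] assms by auto

lemma unitary_mult:
  fixes U :: "complex mat"
  assumes U: "U \<in> carrier_mat n n" "mat_adjoint U * U = 1\<^sub>m n"
    and V: "V \<in> carrier_mat n n" "mat_adjoint V * V = 1\<^sub>m n"
  shows "mat_adjoint (U * V) * (U * V) = 1\<^sub>m n"
proof -
  have "mat_adjoint (U * V) * (U * V) = mat_adjoint V * (mat_adjoint U * (U * V))"
    using U V by (subst mat_adjoint_mult[of _ n n _ n]) (auto intro!: assoc_mult_mat[of _ n n _ n _ n])
  also have "mat_adjoint U * (U * V) = (mat_adjoint U * U) * V"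
    using U V by (intro assoc_mult_mat[symmetric, of _ n n _ n _ n]) auto
  finally show ?thesis using U V by simp
qed

lemma complex_eigenvalue_exists:
  fixes A :: "complex mat"
  assumes A: "A \<in> carrier_mat n n" and n: "n \<noteq> 0"
  obtains e v where "v \<in> carrier_vec n" "v \<noteq> 0\<^sub>v n" "A *\<^sub>v v = e \<cdot>\<^sub>v v"
proof -
  have "degree (char_poly A) \<noteq> 0" using degree_monic_char_poly[OF A] n by simp
  then have "\<not> constant (poly (char_poly A))" by (simp add: constant_degree)
  from fundamental_theorem_of_algebra[OF this] obtain e where "poly (char_poly A) e = 0" by auto
  then have "eigenvalue A e" using eigenvalue_root_char_poly[OF A] by simp
  then show thesis using that A unfolding eigenvalue_def eigenvector_def by auto
qed

text \<open>Deflation by induction on the dimension: a unitary \<open>W\<close> whose first column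
  is an eigenvector turns \<open>A\<close> into a matrix with one scalar block and a Hermitian block
  of size \<open>m\<close>. The diagonal entries are left complex here; their reality is derived
  once positivity is at hand as well.\<close>

theorem hermitian_unitary_diagonalization:
  fixes A :: "complex mat"
  assumes "A \<in> carrier_mat n n" "mat_adjoint A = A"
  shows "\<exists>U d. U \<in> carrier_mat n n \<and> mat_adjoint U * U = 1\<^sub>m n \<and>
    A = U * mat_diag n d * mat_adjoint U"
  using assms
proof (induction n arbitrary: A)
  case 0
  show ?case
    by (intro exI[of _ "1\<^sub>m 0"] exI[of _ "\<lambda>_. 0"]) (use 0 in \<open>auto intro!: eq_matI\<close>)
next
  case (Suc m A)
  let ?n = "Suc m"
  note A = Suc.prems(1) and herm = Suc.prems(2)
  obtain e v where v: "v \<in> carrier_vec ?n" "v \<noteq> 0\<^sub>v ?n" "A *\<^sub>v v = e \<cdot>\<^sub>v v"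
    by (rule complex_eigenvalue_exists[OF A]) auto
  obtain W c where W: "W \<in> carrier_mat ?n ?n" "mat_adjoint W * W = 1\<^sub>m ?n" and c: "col W 0 = c \<cdot>\<^sub>v v"
    using unitary_with_first_column[OF v(1,2)] by blast
  have WW: "W * mat_adjoint W = 1\<^sub>m ?n" by (rule unitary_right_inverse[OF W])
  define B where "B = mat_adjoint W * (A * W)"
  have B: "B \<in> carrier_mat ?n ?n" using A W by (auto simp: B_def)
  have adjB: "mat_adjoint B = B"
  proof -
    have "mat_adjoint B = mat_adjoint (A * W) * W"
      unfolding B_def using A W by (subst mat_adjoint_mult[of _ ?n ?n _ ?n]) auto
    also have "mat_adjoint (A * W) = mat_adjoint W * A"
      using A W by (subst mat_adjoint_mult[of _ ?n ?n _ ?n]) (auto simp: herm)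
    finally show ?thesis unfolding B_def using A W by (auto intro!: assoc_mult_mat[of _ ?n ?n _ ?n _ ?n])
  qed
  have B0: "B $$ (i, 0) = (if i = 0 then e else 0)" if "i < ?n" for i
  proof -
    have "A *\<^sub>v col W 0 = c \<cdot>\<^sub>v (A *\<^sub>v v)"
      unfolding c using A v by (simp add: mult_mat_vec)
    also have "\<dots> = e \<cdot>\<^sub>v col W 0"
      unfolding c v(3) by (simp add: smult_smult_assoc mult.commute)
    finally have *: "A *\<^sub>v col W 0 = e \<cdot>\<^sub>v col W 0" .
    have "col (A * W) 0 = e \<cdot>\<^sub>v col W 0"
      using * A W by (metis col_mult2 zero_less_Suc)
    then have "B $$ (i, 0) = row (mat_adjoint W) i \<bullet> (e \<cdot>\<^sub>v col W 0)"
      using that A W by (auto simp: B_def)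
    also have "\<dots> = e * (row (mat_adjoint W) i \<bullet> col W 0)"
      using W that by (intro scalar_prod_smult_right) auto
    also have "row (mat_adjoint W) i \<bullet> col W 0 = (mat_adjoint W * W) $$ (i, 0)"
      using W(1) that by (intro index_mult_mat(1)[symmetric]) auto
    finally show ?thesis using that by (simp add: W(2))
  qed
  \<comment> \<open>The eigenvector equation only clears the first column; Hermitian symmetry
    carries the zeros over to the first row.\<close>
  have B0': "B $$ (0, j) = (if j = 0 then e else 0)" if "j < ?n" for j
    using B0[OF that] B0[of 0] hermitian_index[OF B adjB that, of 0] by auto
  define A' where "A' = mat m m (\<lambda>(i, j). B $$ (Suc i, Suc j))"
  have A': "A' \<in> carrier_mat m m" by (simp add: A'_def)
  have "mat_adjoint A' = A'"
    by (rule eq_matI) (auto simp: A'_def hermitian_index[OF B adjB])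
  from Suc.IH[OF A' this] obtain U' d where U': "U' \<in> carrier_mat m m" "mat_adjoint U' * U' = 1\<^sub>m m"
    and dec: "A' = U' * mat_diag m d * mat_adjoint U'" by blast
  \<comment> \<open>\<open>V\<close> leaves the eigenvector direction fixed and diagonalizes the
    remaining block, so \<open>W * V\<close> diagonalizes \<open>A\<close>.\<close>
  define V where "V = four_block_mat (1\<^sub>m 1) (0\<^sub>m 1 m) (0\<^sub>m m 1) U'"
  have V: "V \<in> carrier_mat ?n ?n" using U' by (auto simp: V_def)
  have adjV: "mat_adjoint V = four_block_mat (1\<^sub>m 1) (0\<^sub>m 1 m) (0\<^sub>m m 1) (mat_adjoint U')"
    unfolding V_def using U' by (subst mat_adjoint_four_block_diag) auto
  have VV: "mat_adjoint V * V = 1\<^sub>m ?n"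
    unfolding adjV unfolding V_def
    using U' by (subst mult_four_block_mat[of _ 1 1 _ m _ m _ _ 1 _ m]) auto
  let ?d = "case_nat e d"
  have diag: "mat_diag ?n ?d = four_block_mat (mat 1 1 (\<lambda>_. e)) (0\<^sub>m 1 m) (0\<^sub>m m 1) (mat_diag m d)"
    by (rule eq_matI) (auto simp: mat_diag_def split: nat.splits)
  have BV: "B = V * mat_diag ?n ?d * mat_adjoint V"
  proof -
    have "V * mat_diag ?n ?d = four_block_mat (mat 1 1 (\<lambda>_. e)) (0\<^sub>m 1 m) (0\<^sub>m m 1) (U' * mat_diag m d)"
      unfolding diag V_def
      using U' by (subst mult_four_block_mat[of _ 1 1 _ m _ m _ _ 1 _ m]) (auto intro!: cong_four_block_mat simp: left_mult_zero_mat[OF mat_diag_dim])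
    also have "\<dots> * mat_adjoint V = four_block_mat (mat 1 1 (\<lambda>_. e)) (0\<^sub>m 1 m) (0\<^sub>m m 1) A'"
      unfolding adjV dec
      using U' mult_carrier_mat[OF U'(1) mat_diag_dim]
      by (subst mult_four_block_mat[of _ 1 1 _ m _ m _ _ 1 _ m])
        (auto intro!: cong_four_block_mat)
    also have "\<dots> = B"
    proof (rule eq_matI)
      fix i j assume ij: "i < dim_row B" "j < dim_col B"
      then show "four_block_mat (mat 1 1 (\<lambda>_. e)) (0\<^sub>m 1 m) (0\<^sub>m m 1) A' $$ (i, j) = B $$ (i, j)"
        using B B0 B0' by (cases i; cases j) (auto simp: A'_def)
    qed (use A' B in auto)
    finally show ?thesis by simp
  qed
  have "A = W * B * mat_adjoint W"
  proof -
    have "W * B = W * mat_adjoint W * (A * W)"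
      unfolding B_def using A W by (intro assoc_mult_mat[symmetric, of _ ?n ?n _ ?n _ ?n]) auto
    then have "W * B = A * W" using A W by (simp add: WW)
    then have "W * B * mat_adjoint W = A * (W * mat_adjoint W)"
      using A W by (auto intro!: assoc_mult_mat[of _ ?n ?n _ ?n _ ?n])
    then show ?thesis using A by (simp add: WW)
  qed
  also have "\<dots> = (W * V) * mat_diag ?n ?d * mat_adjoint (W * V)"
  proof -
    have adjWV: "mat_adjoint (W * V) = mat_adjoint V * mat_adjoint W"
      using W V by (intro mat_adjoint_mult) auto
    have "W * (V * D * V') * W' = (W * V) * D * (V' * W')"
      if "D \<in> carrier_mat ?n ?n" "V' \<in> carrier_mat ?n ?n" "W' \<in> carrier_mat ?n ?n" for D V' W'
      using W(1) V that by (simp add: assoc_mult_mat[of _ ?n ?n _ ?n _ ?n])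
    then show ?thesis unfolding BV adjWV by this (use W V in auto)
  qed
  finally show ?case
    using W V VV unitary_mult[OF W V VV] by (intro exI[of _ "W * V"] exI[of _ ?d]) auto
qed

section \<open>Spectra and spectral projectors\<close>

abbreviation mat_trace :: "nat \<Rightarrow> complex mat \<Rightarrow> complex" where
  "mat_trace n A \<equiv> \<Sum>i<n. A $$ (i, i)"

lemma mat_trace_commute:
  assumes "A \<in> carrier_mat n n" "B \<in> carrier_mat n n"
  shows "mat_trace n (A * B) = mat_trace n (B * A)"
proof -
  have "mat_trace n (A * B) = (\<Sum>i<n. \<Sum>j<n. A $$ (i, j) * B $$ (j, i))"
    using assms by (auto simp: scalar_prod_def atLeast0LessThan intro!: sum.cong)
  also have "\<dots> = (\<Sum>j<n. \<Sum>i<n. A $$ (i, j) * B $$ (j, i))" by (rule sum.swap)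
  also have "\<dots> = mat_trace n (B * A)"
    using assms by (auto simp: scalar_prod_def atLeast0LessThan mult.commute intro!: sum.cong)
  finally show ?thesis .
qed

text \<open>A density matrix without the normalization of the trace: the eigenvalue blocks and their
  marginals have trace p_j instead of 1.\<close>

definition pos_semidef :: "nat \<Rightarrow> complex mat \<Rightarrow> bool" where
  "pos_semidef n A \<longleftrightarrow> A \<in> carrier_mat n n \<and> mat_adjoint A = A \<and>
     (\<forall>v\<in>carrier_vec n. 0 \<le> Re ((A *\<^sub>v v) \<bullet>c v))"

text \<open>Projectors with the same range absorb each other: every column of \<open>B\<close> lies
  in the range of \<open>A\<close>, where \<open>A\<close> acts as the identity, so
  \<open>A * B = B\<close>. Taking adjoints in \<open>Q * P = P\<close> gives
  \<open>P = P * Q = Q\<close>. This makes the definite description in \<open>eigenprojector\<close>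
  meaningful.\<close>

lemma is_orth_projector_unique:
  assumes P: "is_orth_projector n S P" and Q: "is_orth_projector n S Q"
  shows "P = Q"
proof -
  have absorb: "A * B = B" if A: "is_orth_projector n S A" and B: "is_orth_projector n S B" for A B
  proof (rule eq_matI)
    have cA: "A \<in> carrier_mat n n" and cB: "B \<in> carrier_mat n n"
      using A B by (auto simp: is_orth_projector_def)
    show "dim_row (A * B) = dim_row B" "dim_col (A * B) = dim_col B" using cA cB by auto
    fix i j assume "i < dim_row B" "j < dim_col B"
    then have ij: "i < n" "j < n" using cB by auto
    have "B *\<^sub>v unit_vec n j \<in> S" using B by (auto simp: is_orth_projector_def)
    then obtain w where w: "w \<in> carrier_vec n" "B *\<^sub>v unit_vec n j = A *\<^sub>v w"
      using A by (auto simp: is_orth_projector_def)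
    have "A *\<^sub>v (A *\<^sub>v w) = (A * A) *\<^sub>v w" using cA w by simp
    then have "A *\<^sub>v (B *\<^sub>v unit_vec n j) = B *\<^sub>v unit_vec n j"
      using A w by (simp add: is_orth_projector_def)
    moreover have "B *\<^sub>v unit_vec n j = col B j" using cB ij by (rule_tac eq_vecI) auto
    ultimately have "A *\<^sub>v col B j = col B j" by simp
    then have "col (A * B) j = col B j" using col_mult2[OF cA cB ij(2)] by simp
    then show "(A * B) $$ (i, j) = B $$ (i, j)"
      using cA cB ij by (metis carrier_matD(1) carrier_matD(2) index_col mult_carrier_mat)
  qed
  have "P = mat_adjoint (Q * P)" using absorb[OF Q P] P by (simp add: is_orth_projector_def)
  also have "\<dots> = P * Q"
    using P Q mat_adjoint_mult[of Q n n P n] by (simp add: is_orth_projector_def)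
  also have "\<dots> = Q" by (rule absorb[OF P Q])
  finally show ?thesis .
qed

lemma eigenprojector_eqI:
  assumes "is_orth_projector n (eigenspace A e) P" "dim_row A = n"
  shows "eigenprojector A e = P"
  unfolding eigenprojector_def using assms is_orth_projector_unique by blast

lemma eigenspace_iff:
  assumes "A \<in> carrier_mat n n"
  shows "v \<in> eigenspace A e \<longleftrightarrow> v \<in> carrier_vec n \<and> A *\<^sub>v v = e \<cdot>\<^sub>v v"
proof -
  have "char_matrix A e *\<^sub>v v = 0\<^sub>v n \<longleftrightarrow> A *\<^sub>v v = e \<cdot>\<^sub>v v" if v: "v \<in> carrier_vec n"
  proof (cases "v = 0\<^sub>v n")
    case True
    have "B *\<^sub>v 0\<^sub>v n = 0\<^sub>v n" if "B \<in> carrier_mat n n" for B :: "complex mat"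
      by (rule eq_vecI) (use that in auto)
    from this[OF assms] this[OF char_matrix_closed[OF assms, of e]]
    show ?thesis using True by auto
  next
    case False
    then show ?thesis using eigenvector_char_matrix[OF assms, of v e] assms v
      unfolding eigenvector_def by auto
  qed
  then show ?thesis
    unfolding eigenspace_def mat_kernel[OF char_matrix_closed[OF assms]] by auto
qed

text \<open>Viewing a diagonal matrix as a Jordan matrix with blocks of size 1 makes the
  block-counting formula for kernel dimensions applicable to diagonalizable matrices.\<close>

lemma jordan_matrix_diag:
  "jordan_matrix (map (\<lambda>a. (1, a)) ds) = mat_diag (length ds) (\<lambda>i. ds ! i :: complex)"
proof (induction ds)
  case Nil
  show ?case by (rule eq_matI) (auto simp: jordan_matrix_def mat_diag_def)
next
  case (Cons d ds)
  have sl: "sum_list (map fst (map (Pair (1::nat)) ds)) = length ds"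
    by (induction ds) auto
  show ?case
    unfolding list.map jordan_matrix_Cons Cons.IH sl
    by (rule eq_matI) (auto simp: mat_diag_def jordan_block_def nth_Cons split: nat.splits)
qed

lemma proots_linear_factors:
  fixes xs :: "'a::idom list"
  shows "proots (\<Prod>a\<leftarrow>xs. [:- a, 1:]) = mset xs"
  proof (induction xs)
  case (Cons a xs)
  have "(\<Prod>a\<leftarrow>xs. [:- a, 1:]) \<noteq> 0" by (auto simp: prod_list_zero_iff)
  with Cons show ?case
    using proots_mult[of "[:- a, 1:]" "\<Prod>a\<leftarrow>xs. [:- a, 1:]"]
    by (auto simp del: mult_pCons_left)
qed simp

text \<open>Fixing one diagonalization lets trace, spectrum, multiplicities and eigenprojectors all
  be expressed through the same \<open>U\<close> and \<open>d\<close>. Only the values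
  \<open>d i\<close> with \<open>i < n\<close> enter.\<close>

locale unitary_diagonalization =
  fixes n :: nat and A U :: "complex mat" and d :: "nat \<Rightarrow> complex"
  assumes U: "U \<in> carrier_mat n n" and UU: "mat_adjoint U * U = 1\<^sub>m n"
    and A_eq: "A = U * mat_diag n d * mat_adjoint U"
begin

lemma A: "A \<in> carrier_mat n n" using U unfolding A_eq by auto

lemma conj_mult:
  assumes X: "X \<in> carrier_mat n n" and Y: "Y \<in> carrier_mat n n"
  shows "(U * X * mat_adjoint U) * (U * Y * mat_adjoint U) = U * (X * Y) * mat_adjoint U"
proof -
  have U': "mat_adjoint U \<in> carrier_mat n n" using U by simp
  note assoc = assoc_mult_mat[of _ n n _ n _ n]
  have "(U * X * mat_adjoint U) * (U * Y * mat_adjoint U) =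
      U * (X * ((mat_adjoint U * U) * (Y * mat_adjoint U)))"
    using U U' X Y by (simp add: assoc)
  also have "\<dots> = U * (X * Y) * mat_adjoint U"
    using U U' X Y unfolding UU by (simp add: assoc)
  finally show ?thesis .
qed

lemma trace_conj:
  assumes X: "X \<in> carrier_mat n n"
  shows "mat_trace n (U * X * mat_adjoint U) = mat_trace n X"
proof -
  have U': "mat_adjoint U \<in> carrier_mat n n" using U by simp
  have "mat_trace n (U * X * mat_adjoint U) = mat_trace n (mat_adjoint U * (U * X))"
    using U U' X by (intro mat_trace_commute) auto
  also have "mat_adjoint U * (U * X) = (mat_adjoint U * U) * X"
    using U U' X by (intro assoc_mult_mat[symmetric, of _ n n _ n _ n])
  finally show ?thesis using X by (simp add: UU)
qed

lemma trace_eq: "mat_trace n A = (\<Sum>i<n. d i)"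
  unfolding A_eq trace_conj[OF mat_diag_dim] by (simp add: mat_diag_def)

lemma similar: "similar_mat A (mat_diag n d)"
  unfolding similar_mat_def
  by (rule exI[of _ U], rule exI[of _ "mat_adjoint U"], rule similar_mat_witI[of _ _ n])
    (use A U UU unitary_right_inverse[OF U UU] A_eq in auto)

lemma char_poly_eq: "char_poly A = (\<Prod>a\<leftarrow>map d [0..<n]. [:- a, 1:])"
proof -
  have "char_poly A = char_poly (mat_diag n d)" by (rule char_poly_similar[OF similar])
  also have "\<dots> = (\<Prod>a\<leftarrow>diag_mat (mat_diag n d). [:- a, 1:])"
    by (rule char_poly_upper_triangular[of _ n]) (auto simp: mat_diag_def)
  also have "diag_mat (mat_diag n d) = map d [0..<n]"
    by (auto simp: diag_mat_def mat_diag_def)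
  finally show ?thesis .
qed

lemma proots_char_poly: "proots (char_poly A) = image_mset d (mset_set {..<n})"
  unfolding char_poly_eq proots_linear_factors by (simp add: atLeast0LessThan)

lemma eigenvalue_iff: "eigenvalue A e \<longleftrightarrow> e \<in> d ` {..<n}"
  unfolding eigenvalue_root_char_poly[OF A] char_poly_eq
  by (auto simp: poly_prod_list prod_list_zero_iff)

text \<open>The eigenspace is the generalized eigenspace of exponent 1, to which each Jordan block
  of eigenvalue \<open>e\<close> contributes one dimension; all blocks here have size 1.\<close>

lemma eigenspace_dim_eq: "eigenspace_dim A e = card {i. i < n \<and> d i = e}"
proof -
  let ?ds = "map d [0..<n]"
  have "jordan_matrix (map (\<lambda>a. (1, a)) ?ds) = mat_diag n d"
    unfolding jordan_matrix_diag by (rule eq_matI) (auto simp: mat_diag_def)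
  then have "jordan_nf A (map (\<lambda>a. (1, a)) ?ds)"
    using similar unfolding jordan_nf_def by auto
  from dim_gen_eigenspace[OF this, of e 1]
  have "kernel_dim (char_matrix A e ^\<^sub>m 1) =
      (\<Sum>k\<leftarrow>map fst (filter (\<lambda>(k, a). a = e) (map (\<lambda>a. (1, a)) ?ds)). min 1 k)"
    unfolding dim_gen_eigenspace_def by simp
  also have "\<dots> = length (filter (\<lambda>a. a = e) ?ds)"
    by (induction n) (auto)
  also have "\<dots> = card {i. i < n \<and> d i = e}"
    by (auto simp: length_filter_conv_card intro!: arg_cong[of _ _ card])
  finally show ?thesis unfolding eigenspace_dim_def using A by (simp add: char_matrix_def)
qed

definition proj :: "complex \<Rightarrow> complex mat" where
  "proj e = U * mat_diag n (\<lambda>i. if d i = e then 1 else 0) * mat_adjoint U"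

lemma proj_carrier: "proj e \<in> carrier_mat n n"
  using U by (auto simp: proj_def)

lemma trace_proj: "mat_trace n (proj e) = of_nat (eigenspace_dim A e)"
  unfolding eigenspace_dim_eq proj_def trace_conj[OF mat_diag_dim]
  by (simp add: mat_diag_def sum.If_cases Int_def)

text \<open>From \<open>A * proj e = e\<close> times \<open>proj e\<close>, the range lies in the
  eigenspace. Conversely, in the coordinates \<open>w\<close> given by \<open>mat_adjoint U\<close>,
  an eigenvector satisfies \<open>d i * w $ i = e * w $ i\<close>, so \<open>w\<close> vanishes
  wherever \<open>d i\<close> differs from \<open>e\<close> and the coordinate projector fixes
  it.\<close>

lemma is_orth_projector_proj: "is_orth_projector n (eigenspace A e) (proj e)"
proof -
  let ?D = "mat_diag n (\<lambda>i. if d i = e then 1 else 0) :: complex mat"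
  have U': "mat_adjoint U \<in> carrier_mat n n" using U by simp
  have UU': "U * mat_adjoint U = 1\<^sub>m n" by (rule unitary_right_inverse[OF U UU])
  have adj: "mat_adjoint (proj e) = proj e"
  proof -
    have "mat_adjoint (proj e) = U * mat_adjoint (U * ?D)"
      unfolding proj_def using U by (subst mat_adjoint_mult[of _ n n _ n]) auto
    also have "mat_adjoint (U * ?D) = ?D * mat_adjoint U"
      using U by (subst mat_adjoint_mult[of _ n n _ n]) (auto simp: mat_adjoint_mat_diag if_distrib cong: if_cong)
    finally show ?thesis unfolding proj_def using U U' by (simp add: assoc_mult_mat[of _ n n _ n _ n])
  qed
  have idem: "proj e * proj e = proj e"
    unfolding proj_def conj_mult[OF mat_diag_dim mat_diag_dim] mat_diag_diag
    by (simp add: if_distrib cong: if_cong)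
  have AP: "A * proj e = e \<cdot>\<^sub>m proj e"
  proof -
    have "A * proj e = U * (mat_diag n d * ?D) * mat_adjoint U"
      unfolding proj_def A_eq conj_mult[OF mat_diag_dim mat_diag_dim] ..
    also have "mat_diag n d * ?D = e \<cdot>\<^sub>m ?D"
      by (rule eq_matI) (auto simp: mat_diag_diag, auto simp: mat_diag_def)
    also have "U * (e \<cdot>\<^sub>m ?D) * mat_adjoint U = e \<cdot>\<^sub>m proj e"
      unfolding proj_def using U U'
      by (simp add: mult_smult_distrib[of _ n n _ n] mult_smult_assoc_mat[of _ n n _ n])
    finally show ?thesis .
  qed
  have "(\<lambda>v. proj e *\<^sub>v v) ` carrier_vec n = eigenspace A e"
  proof (intro equalityI subsetI)
    fix w assume "w \<in> (\<lambda>v. proj e *\<^sub>v v) ` carrier_vec n"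
    then obtain v where v: "v \<in> carrier_vec n" "w = proj e *\<^sub>v v" by auto
    have "A *\<^sub>v w = (A * proj e) *\<^sub>v v"
      using A v proj_carrier[of e] by simp
    also have "\<dots> = e \<cdot>\<^sub>v w"
      unfolding AP v(2) using v(1) proj_carrier[of e] by (rule_tac eq_vecI) auto
    finally show "w \<in> eigenspace A e"
      using v proj_carrier[of e] by (simp add: eigenspace_iff[OF A])
  next
    fix v assume "v \<in> eigenspace A e"
    then have v: "v \<in> carrier_vec n" and Av: "A *\<^sub>v v = e \<cdot>\<^sub>v v" by (auto simp: eigenspace_iff[OF A])
    define w where "w = mat_adjoint U *\<^sub>v v"
    have w: "w \<in> carrier_vec n" using U' v by (simp add: w_def)
    have Uw: "U *\<^sub>v w = v"
    proof -
      have "U *\<^sub>v w = (U * mat_adjoint U) *\<^sub>v v" unfolding w_def using U U' v by (intro assoc_mult_mat_vec[symmetric])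
      then show ?thesis using v by (simp add: UU')
    qed
    have "mat_adjoint U *\<^sub>v (A *\<^sub>v v) = (mat_adjoint U * A) *\<^sub>v v"
      using U' A v by simp
    also have "mat_adjoint U * A = (mat_adjoint U * U) * (mat_diag n d * mat_adjoint U)"
    proof -
      have "V * (U * D * V) = (V * U) * (D * V)"
        if "D \<in> carrier_mat n n" "V \<in> carrier_mat n n" for D V
        using U that by (simp add: assoc_mult_mat[of _ n n _ n _ n])
      then show ?thesis unfolding A_eq using U' by simp
    qed
    also have "\<dots> = mat_diag n d * mat_adjoint U" unfolding UU using mult_carrier_mat[OF mat_diag_dim U'] by (rule left_mult_one_mat)
    also have "\<dots> *\<^sub>v v = mat_diag n d *\<^sub>v w" unfolding w_def using mat_diag_dim U' v by (rule assoc_mult_mat_vec)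
    finally have Dw: "mat_diag n d *\<^sub>v w = e \<cdot>\<^sub>v w"
      unfolding Av w_def using U' v by (simp add: mult_mat_vec)
    have diag_vec: "(mat_diag n f *\<^sub>v w) $ i = f i * w $ i" if "i < n" for f i
    proof -
      have "(mat_diag n f *\<^sub>v w) $ i = (\<Sum>j<n. (if i = j then f j else 0) * w $ j)"
        using that w by (auto simp: mat_diag_def scalar_prod_def atLeast0LessThan)
      also have "\<dots> = (\<Sum>j<n. if i = j then f i * w $ i else 0)"
        by (rule sum.cong) auto
      finally show ?thesis using that by simp
    qed
    have "d i * w $ i = e * w $ i" if "i < n" for i
      using diag_vec[OF that, of d] that w unfolding Dw by auto
    then have "?D *\<^sub>v w = w"
      using w by (intro eq_vecI) (auto simp: diag_vec carrier_matD[OF mat_diag_dim] simp del: index_mult_mat_vec)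
    then have "U *\<^sub>v (?D *\<^sub>v (mat_adjoint U *\<^sub>v v)) = v" using Uw by (simp add: w_def)
    moreover have "proj e *\<^sub>v v = U *\<^sub>v (?D *\<^sub>v (mat_adjoint U *\<^sub>v v))"
    proof -
      have "proj e *\<^sub>v v = (U * ?D) *\<^sub>v (mat_adjoint U *\<^sub>v v)"
        unfolding proj_def by (rule assoc_mult_mat_vec[OF mult_carrier_mat[OF U mat_diag_dim] U' v])
      also have "\<dots> = U *\<^sub>v (?D *\<^sub>v (mat_adjoint U *\<^sub>v v))"
        by (rule assoc_mult_mat_vec[OF U mat_diag_dim]) (use U' v in auto)
      finally show ?thesis .
    qed
    ultimately have "v = proj e *\<^sub>v v" by metis
    then show "v \<in> (\<lambda>v. proj e *\<^sub>v v) ` carrier_vec n" using v by (rule image_eqI)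
  qed
  then show ?thesis unfolding is_orth_projector_def using proj_carrier adj idem by simp
qed

lemma eigenprojector_eq: "eigenprojector A e = proj e"
  by (rule eigenprojector_eqI[OF is_orth_projector_proj]) (use A in auto)

text \<open>\<open>d i\<close> is a diagonal entry of \<open>mat_adjoint U * (A * U)\<close>.
  Writing it as a value of the quadratic form transfers symmetry and positivity of \<open>A\<close>
  to its eigenvalues.\<close>

lemma quadratic_form: 
  assumes "i < n"
  shows "d i = (A *\<^sub>v col U i) \<bullet>c col U i"
proof -
  have U': "mat_adjoint U \<in> carrier_mat n n" using U by simp
  have "mat_diag n d = (mat_adjoint U * U) * mat_diag n d * (mat_adjoint U * U)"
    unfolding UU by (metis left_mult_one_mat right_mult_one_mat mat_diag_dim)
  also have "\<dots> = mat_adjoint U * (A * U)"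
  proof -
    have "(V * U) * D * (V * U) = V * ((U * D * V) * U)"
      if "D \<in> carrier_mat n n" "V \<in> carrier_mat n n" for D V
      using U that by (simp add: assoc_mult_mat[of _ n n _ n _ n])
    then show ?thesis unfolding A_eq using U' by simp
  qed
  finally have "d i = (mat_adjoint U * (A * U)) $$ (i, i)"
    using assms by (metis (mono_tags, lifting) mat_diag_def index_mat(1) split_conv)
  also have "\<dots> = row (mat_adjoint U) i \<bullet> col (A * U) i" using assms U U' A by simp
  also have "col (A * U) i = A *\<^sub>v col U i" by (rule col_mult2[OF A U assms])
  also have "row (mat_adjoint U) i = conjugate (col U i)"
    by (rule eq_vecI) (use U assms in auto)
  also have "conjugate (col U i) \<bullet> (A *\<^sub>v col U i) = (A *\<^sub>v col U i) \<bullet>c col U i"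
    by (rule comm_scalar_prod[of _ n]) (use U A assms in auto)
  finally show ?thesis .
qed

end

text \<open>Each \<open>d i\<close> is a value of the quadratic form of \<open>A\<close>: Hermitian
  symmetry makes it equal to its own conjugate, and positivity makes it nonnegative.\<close>

lemma pos_semidef_diagonalization:
  assumes "pos_semidef n A"
  shows "\<exists>U x. unitary_diagonalization n A U (\<lambda>i. complex_of_real (x i)) \<and> (\<forall>i<n. 0 \<le> x i)"
proof -
  have A: "A \<in> carrier_mat n n" and herm: "mat_adjoint A = A"
    and pos: "\<And>v. v \<in> carrier_vec n \<Longrightarrow> 0 \<le> Re ((A *\<^sub>v v) \<bullet>c v)"
    using assms by (auto simp: pos_semidef_def)
  obtain U d where Ud: "U \<in> carrier_mat n n" "mat_adjoint U * U = 1\<^sub>m n"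
    "A = U * mat_diag n d * mat_adjoint U"
    using hermitian_unitary_diagonalization[OF A herm] by blast
  then interpret unitary_diagonalization n A U d by unfold_locales
  have real: "d i = complex_of_real (Re (d i))" if "i < n" for i
  proof -
    have u: "col U i \<in> carrier_vec n" using U that by auto
    have "cnj (d i) = conjugate (col U i) \<bullet> (A *\<^sub>v col U i)"
    proof -
      have "cnj (d i) = conjugate ((A *\<^sub>v col U i) \<bullet>c col U i)"
        unfolding quadratic_form[OF that] by simp
      also have "\<dots> = col U i \<bullet>c (A *\<^sub>v col U i)"
        using A u by (subst conjugate_sprod_vec[of _ n]) (auto intro!: comm_scalar_prod)
      also have "\<dots> = (A *\<^sub>v col U i) \<bullet>c col U i"
        using cscalar_prod_mat_adjoint[OF A u u] by (simp add: herm)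
      also have "\<dots> = conjugate (col U i) \<bullet> (A *\<^sub>v col U i)"
        using A u by (intro comm_scalar_prod[of _ n]) auto
      finally show ?thesis .
    qed
    also have "\<dots> = d i"
      unfolding quadratic_form[OF that] using A u by (intro comm_scalar_prod[of _ n]) auto
    finally show ?thesis by (simp add: complex_eq_iff)
  qed
  \<comment> \<open>Reality of \<open>d i\<close> is known for \<open>i < n\<close> only;
    \<open>mat_diag n\<close> ignores all other indices, so \<open>Re\<close> may be taken
    everywhere.\<close>
  have "mat_diag n d = mat_diag n (\<lambda>i. complex_of_real (Re (d i)))"
    by (rule eq_matI) (auto simp: mat_diag_def real[symmetric])
  with Ud have "unitary_diagonalization n A U (\<lambda>i. complex_of_real (Re (d i)))"
    by unfold_locales auto
  moreover have "0 \<le> Re (d i)" if "i < n" for i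
    unfolding quadratic_form[OF that] by (rule pos) (use U that in auto)
  ultimately show ?thesis by (intro exI[of _ U] exI[of _ "\<lambda>i. Re (d i)"]) auto
qed

section \<open>An entropy bound\<close>

text \<open>\<open>nim\<close> is never farther from \<open>x\<close> than the lower multiple
  \<open>y * of_int \<lfloor>x / y\<rfloor>\<close>, which lies between 0 and \<open>x\<close>. For
  \<open>y = 0\<close> the rounded value is 0 and equality holds.\<close>

lemma abs_diff_nim_le:
  assumes "0 \<le> y" "0 \<le> x"
  shows "\<bar>x - nim y x\<bar> \<le> x"
proof (cases "y = 0")
  case False
  with assms have y: "y > 0" by simp
  have "0 \<le> y * of_int \<lfloor>x / y\<rfloor>" using assms y by simp
  moreover have "y * of_int \<lfloor>x / y\<rfloor> \<le> x"
    using floor_divide_lower[OF y, of x] by (simp add: mult.commute)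
  moreover have "x \<le> y * of_int \<lceil>x / y\<rceil>"
    using ceiling_divide_upper[OF y, of x] by (simp add: mult.commute)
  ultimately show ?thesis using False by (auto simp: nim_def)
qed (use assms in \<open>simp add: nim_def\<close>)

text \<open>Gibbs' inequality against the uniform distribution, for numbers of total mass
  \<open>p\<close> instead of 1. If \<open>p = 0\<close>, the index set on the left is empty and
  both sides vanish.\<close>

lemma weighted_entropy_le:
  fixes x :: "nat \<Rightarrow> real"
  assumes N: "N \<ge> 1" and y: "0 \<le> y" and nonneg: "\<And>i. i < N \<Longrightarrow> 0 \<le> x i"
    and p: "(\<Sum>i<N. x i) = p"
  shows "- (\<Sum>i | i < N \<and> x i \<noteq> 0. \<bar>x i - nim y (x i)\<bar> * log 2 (x i / p)) \<le> p * log 2 (real N)"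
proof -
  let ?I = "{i. i < N \<and> x i \<noteq> 0}"
  have sumI: "(\<Sum>i\<in>?I. x i) = p"
    unfolding p[symmetric] by (rule sum.mono_neutral_left) auto
  have p0: "0 \<le> p" unfolding p[symmetric] by (rule sum_nonneg) (use nonneg in auto)
  \<comment> \<open>The correction \<open>(p / N - x i) / ln 2\<close> may have either sign for a
    single \<open>i\<close>; only its sum over the nonzero entries is guaranteed to be at most
    0.\<close>
  have le: "- (\<bar>x i - nim y (x i)\<bar> * log 2 (x i / p)) \<le> x i * log 2 (real N) + (p / N - x i) / ln 2"
    if "i \<in> ?I" for i
  proof -
    have xi: "0 < x i" using nonneg[of i] that by auto
    have xp: "x i \<le> p" unfolding p[symmetric] by (rule member_le_sum) (use that nonneg in auto)
    then have p: "0 < p" using xi by simp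
    have "log 2 (x i / p) \<le> 0" using xi p xp by (simp add: log_def divide_nonpos_pos)
    then have "\<bar>x i - nim y (x i)\<bar> * (- log 2 (x i / p)) \<le> x i * (- log 2 (x i / p))"
      by (intro mult_right_mono abs_diff_nim_le) (use y xi in auto)
    also have "\<dots> = x i * (ln N + ln (p / (N * x i))) / ln 2"
      using xi p N by (simp add: log_def ln_div ln_mult field_simps)
    \<comment> \<open>\<open>ln t \<le> t - 1\<close> is tangent at \<open>t = 1\<close>, i.e. at the uniform distribution \<open>x i = p / N\<close>\<close>
    also have "\<dots> \<le> x i * (ln N + (p / (N * x i) - 1)) / ln 2"
      using xi p N by (intro divide_right_mono mult_left_mono add_left_mono ln_le_minus_one) auto
    also have "\<dots> = x i * log 2 (real N) + (p / N - x i) / ln 2"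
      using xi N by (simp add: log_def field_simps)
    finally show ?thesis by simp
  qed
  have "- (\<Sum>i\<in>?I. \<bar>x i - nim y (x i)\<bar> * log 2 (x i / p)) \<le>
      (\<Sum>i\<in>?I. x i * log 2 (real N) + (p / N - x i) / ln 2)"
    unfolding sum_negf[symmetric] by (rule sum_mono) (rule le)
  also have "\<dots> = p * log 2 (real N) + (card ?I * (p / N) - p) / ln 2"
    by (simp add: sum.distrib sumI sum_subtractf flip: sum_distrib_right sum_divide_distrib)
  also have "\<dots> \<le> p * log 2 (real N)"
  proof -
    \<comment> \<open>With fewer than \<open>N\<close> nonzero entries the corrections add up to
      something at most 0, not exactly 0; this is the case of a marginal block of lower
      rank.\<close>
    have "card ?I \<le> card {..<N}" by (rule card_mono) auto
    then have "card ?I * (p / N) \<le> N * (p / N)" using p0 by (intro mult_right_mono) auto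
    also have "\<dots> = p" using N by simp
    finally show ?thesis by (simp add: divide_nonpos_pos)
  qed
  finally show ?thesis .
qed

section \<open>Spectra of positive semidefinite matrices as indexed families\<close>

lemma (in unitary_diagonalization) nonzero_eigenvalues_eq:
  assumes "\<And>i. d i = complex_of_real (x i)"
  shows "nonzero_eigenvalues A = image_mset x (mset_set {i. i < n \<and> x i \<noteq> 0})"
proof -
  have "{i \<in> {..<n}. complex_of_real (x i) \<noteq> 0} = {i. i < n \<and> x i \<noteq> 0}" by auto
  then show ?thesis
    unfolding nonzero_eigenvalues_def proots_char_poly filter_mset_image_mset multiset.map_comp
    by (simp add: assms comp_def filter_mset_mset_set)
qed

text \<open>The entropy bound speaks of a family indexed below \<open>N\<close>, zeros included,
  whereas M sums over a multiset of nonzero eigenvalues; this passes from one to the other, with the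
  sum of the family given by the trace.\<close>

lemma pos_semidef_eigenvalues:
  assumes "pos_semidef n A"
  obtains x where "\<And>i. i < n \<Longrightarrow> 0 \<le> x i" "complex_of_real (\<Sum>i<n. x i) = mat_trace n A"
    "nonzero_eigenvalues A = image_mset x (mset_set {i. i < n \<and> x i \<noteq> 0})"
proof -
  obtain U x where "unitary_diagonalization n A U (\<lambda>i. complex_of_real (x i))" and x: "\<forall>i<n. 0 \<le> x i"
    using pos_semidef_diagonalization[OF assms] by blast
  then interpret unitary_diagonalization n A U "\<lambda>i. complex_of_real (x i)" by simp
  show thesis using that[of x] x nonzero_eigenvalues_eq[of x] trace_eq by simp
qed

lemma pos_semidef_smult:
  assumes "pos_semidef n A" "0 \<le> c"
  shows "pos_semidef n (complex_of_real c \<cdot>\<^sub>m A)"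
proof -
  have A: "A \<in> carrier_mat n n" "mat_adjoint A = A" using assms by (auto simp: pos_semidef_def)
  have "0 \<le> Re ((complex_of_real c \<cdot>\<^sub>m A *\<^sub>v v) \<bullet>c v)" if v: "v \<in> carrier_vec n" for v
  proof -
    have "complex_of_real c \<cdot>\<^sub>m A *\<^sub>v v = complex_of_real c \<cdot>\<^sub>v (A *\<^sub>v v)"
      by (rule eq_vecI) (use A v in auto)
    moreover have "(complex_of_real c \<cdot>\<^sub>v (A *\<^sub>v v)) \<bullet>c v = complex_of_real c * ((A *\<^sub>v v) \<bullet>c v)"
      by (rule smult_scalar_prod_distrib[of _ n]) (use A v in auto)
    ultimately show ?thesis using assms v by (simp add: pos_semidef_def)
  qed
  then show ?thesis using A by (simp add: pos_semidef_def mat_adjoint_smult)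
qed

text \<open>Since \<open>P\<close> is idempotent and self-adjoint, its quadratic form at
  \<open>v\<close> is the squared norm of \<open>P\<close> applied to \<open>v\<close>.\<close>

lemma pos_semidef_orth_projector:
  assumes "is_orth_projector n S P"
  shows "pos_semidef n P"
proof -
  have P: "P \<in> carrier_mat n n" "mat_adjoint P = P" "P * P = P"
    using assms by (auto simp: is_orth_projector_def)
  have "0 \<le> Re ((P *\<^sub>v v) \<bullet>c v)" if v: "v \<in> carrier_vec n" for v
  proof -
    have "(P *\<^sub>v v) \<bullet>c v = (P *\<^sub>v (P *\<^sub>v v)) \<bullet>c v"
      using assoc_mult_mat_vec[OF P(1) P(1) v] by (simp add: P(3))
    also have "\<dots> = (P *\<^sub>v v) \<bullet>c (P *\<^sub>v v)"
      using P v by (subst cscalar_prod_mat_adjoint[of _ n n]) auto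
    also have "\<dots> \<ge> 0" by (rule conjugate_square_ge_0_vec)
    finally show ?thesis by (simp add: less_eq_complex_def)
  qed
  then show ?thesis using P by (simp add: pos_semidef_def)
qed

section \<open>The bound for positive trace-preserving maps\<close>

text \<open>Common interface of both partial traces: positivity makes the spectrum of a marginal
  block nonnegative, and trace preservation fixes its sum.\<close>

definition positive_trace_preserving :: "nat \<Rightarrow> nat \<Rightarrow> (complex mat \<Rightarrow> complex mat) \<Rightarrow> bool" where
  "positive_trace_preserving n N f \<longleftrightarrow>
     (\<forall>X. pos_semidef n X \<longrightarrow> pos_semidef N (f X) \<and> mat_trace N (f X) = mat_trace n X)"

lemma density_matrix_pos_semidef: "density_matrix n \<rho> \<Longrightarrow> pos_semidef n \<rho>"
  by (simp add: density_matrix_def pos_semidef_def)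

text \<open>The sum to 1 is the trace of \<rho> regrouped by distinct eigenvalues: the diagonal
  entries equal to \<eta> are as many as the dimension of its eigenspace.\<close>

lemma density_matrix_eigenspaces:
  assumes "density_matrix n \<rho>"
  defines "S \<equiv> {\<eta>. eigenvalue \<rho> (complex_of_real \<eta>)}"
  shows "finite S" and "\<And>\<eta>. \<eta> \<in> S \<Longrightarrow> 0 \<le> \<eta>"
    and "(\<Sum>\<eta>\<in>S. \<eta> * real (eigenspace_dim \<rho> (complex_of_real \<eta>))) = 1"
    and "\<And>e. pos_semidef n (eigenprojector \<rho> e)"
    and "\<And>e. mat_trace n (eigenprojector \<rho> e) = of_nat (eigenspace_dim \<rho> e)"
proof -
  obtain U x where diag: "unitary_diagonalization n \<rho> U (\<lambda>i. complex_of_real (x i))"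
    and x: "\<forall>i<n. 0 \<le> x i"
    using pos_semidef_diagonalization[OF density_matrix_pos_semidef[OF assms(1)]] by blast
  interpret unitary_diagonalization n \<rho> U "\<lambda>i. complex_of_real (x i)" by (rule diag)
  have S: "S = x ` {..<n}" unfolding S_def eigenvalue_iff by (auto simp: image_iff)
  show "finite S" "\<And>\<eta>. \<eta> \<in> S \<Longrightarrow> 0 \<le> \<eta>" using x by (auto simp: S)
  show "pos_semidef n (eigenprojector \<rho> e)" for e
    unfolding eigenprojector_eq by (rule pos_semidef_orth_projector[OF is_orth_projector_proj])
  show "mat_trace n (eigenprojector \<rho> e) = of_nat (eigenspace_dim \<rho> e)" for e
    unfolding eigenprojector_eq by (rule trace_proj)
  have "(\<Sum>\<eta>\<in>S. \<eta> * real (eigenspace_dim \<rho> (complex_of_real \<eta>))) = (\<Sum>\<eta>\<in>S. \<Sum>i | i \<in> {..<n} \<and> x i = \<eta>. x i)"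
    by (rule sum.cong) (auto simp: eigenspace_dim_eq)
  also have "\<dots> = (\<Sum>i<n. x i)" unfolding S by (rule sum.image_gen[symmetric]) simp
  also have "complex_of_real \<dots> = 1"
    using trace_eq assms(1) by (simp add: density_matrix_def)
  finally show "(\<Sum>\<eta>\<in>S. \<eta> * real (eigenspace_dim \<rho> (complex_of_real \<eta>))) = 1"
    unfolding of_real_eq_1_iff .
qed

text \<open>The projector has trace equal to the multiplicity, so the block has trace \<eta> times
  that multiplicity, and \<open>ptr\<close> preserves it. The case \<eta> = 0 is included and later
  shows that the kernel of a pure state contributes nothing.\<close>

lemma density_matrix_marginal_spectrum:
  assumes \<rho>: "density_matrix n \<rho>" and ptr: "positive_trace_preserving n N ptr"
    and \<eta>: "0 \<le> \<eta>"
  obtains x where "\<And>i. i < N \<Longrightarrow> 0 \<le> x i"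
    "(\<Sum>i<N. x i) = \<eta> * real (eigenspace_dim \<rho> (complex_of_real \<eta>))"
    "nonzero_eigenvalues (ptr (complex_of_real \<eta> \<cdot>\<^sub>m eigenprojector \<rho> (complex_of_real \<eta>)))
      = image_mset x (mset_set {i. i < N \<and> x i \<noteq> 0})"
proof -
  let ?P = "eigenprojector \<rho> (complex_of_real \<eta>)"
  have P: "pos_semidef n ?P" by (rule density_matrix_eigenspaces[OF \<rho>])
  then have X: "pos_semidef n (complex_of_real \<eta> \<cdot>\<^sub>m ?P)" using \<eta> by (rule pos_semidef_smult)
  then have Y: "pos_semidef N (ptr (complex_of_real \<eta> \<cdot>\<^sub>m ?P))"
    and tr: "mat_trace N (ptr (complex_of_real \<eta> \<cdot>\<^sub>m ?P)) = mat_trace n (complex_of_real \<eta> \<cdot>\<^sub>m ?P)"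
    using ptr by (auto simp: positive_trace_preserving_def)
  have "mat_trace n (complex_of_real \<eta> \<cdot>\<^sub>m ?P) = complex_of_real \<eta> * mat_trace n ?P"
    using P by (auto simp: pos_semidef_def sum_distrib_left)
  also have "\<dots> = complex_of_real (\<eta> * real (eigenspace_dim \<rho> (complex_of_real \<eta>)))"
    by (simp add: density_matrix_eigenspaces(5)[OF \<rho>])
  finally have tr': "mat_trace N (ptr (complex_of_real \<eta> \<cdot>\<^sub>m ?P)) =
    complex_of_real (\<eta> * real (eigenspace_dim \<rho> (complex_of_real \<eta>)))"
    using tr by simp
  show thesis
    by (rule pos_semidef_eigenvalues[OF Y], rule that) (auto simp only: tr' of_real_eq_iff)
qed

lemma M_marginal_le:
  assumes \<rho>: "density_matrix n \<rho>" and ptr: "positive_trace_preserving n N ptr" and N: "N \<ge> 1"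
  shows "M_marginal ptr \<rho> \<le> log 2 (real N)"
proof -
  let ?S = "{\<eta>. eigenvalue \<rho> (complex_of_real \<eta>)}"
  let ?p = "\<lambda>\<eta>. \<eta> * real (eigenspace_dim \<rho> (complex_of_real \<eta>))"
  note S = density_matrix_eigenspaces[OF \<rho>]
  have "M_marginal ptr \<rho> \<le> (\<Sum>\<eta>\<in>?S. ?p \<eta> * log 2 (real N))"
    unfolding M_marginal_def sum_negf[symmetric]
  proof (rule sum_mono)
    fix \<eta> assume "\<eta> \<in> ?S"
    then have \<eta>: "0 \<le> \<eta>" by (rule S(2))
    obtain x where x: "\<And>i. i < N \<Longrightarrow> 0 \<le> x i" "(\<Sum>i<N. x i) = ?p \<eta>"
      and ev: "nonzero_eigenvalues (ptr (complex_of_real \<eta> \<cdot>\<^sub>m eigenprojector \<rho> (complex_of_real \<eta>)))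
        = image_mset x (mset_set {i. i < N \<and> x i \<noteq> 0})"
      using density_matrix_marginal_spectrum[OF \<rho> ptr \<eta>] by blast
    \<comment> \<open>The denominator inside the logarithm in the definition of M is precisely the
      total mass of \<open>x\<close>, so the entropy bound applies with \<open>p\<close> equal to it
      and \<open>y\<close> equal to \<eta>.\<close>
    show "- (\<Sum>x \<in># nonzero_eigenvalues (ptr (complex_of_real \<eta> \<cdot>\<^sub>m eigenprojector \<rho> (complex_of_real \<eta>))).
            \<bar>x - nim \<eta> x\<bar> * log 2 (x / ?p \<eta>)) \<le> ?p \<eta> * log 2 (real N)"
      using weighted_entropy_le[OF N \<eta> x] unfolding ev
      by (simp add: multiset.map_comp comp_def flip: sum_unfold_sum_mset)
  qed
  also have "\<dots> = log 2 (real N)"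
    unfolding sum_distrib_right[symmetric] S(3) by simp
  finally show ?thesis .
qed

section \<open>Pure states\<close>

lemma pure_state_mult_vec:
  assumes "\<psi> \<in> carrier_vec n" "v \<in> carrier_vec n"
  shows "pure_state \<psi> *\<^sub>v v = (v \<bullet>c \<psi>) \<cdot>\<^sub>v \<psi>"
  by (rule eq_vecI)
    (use assms in \<open>auto simp: pure_state_def scalar_prod_def sum_distrib_left ac_simps\<close>)

lemma pure_state_carrier: "\<psi> \<in> carrier_vec n \<Longrightarrow> pure_state \<psi> \<in> carrier_mat n n"
  by (auto simp: pure_state_def)

lemma trace_pure_state:
  assumes "\<psi> \<in> carrier_vec n"
  shows "mat_trace n (pure_state \<psi>) = \<psi> \<bullet>c \<psi>"
  using assms by (auto simp: pure_state_def scalar_prod_def atLeast0LessThan)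

lemma pure_state_idem:
  assumes \<psi>: "\<psi> \<in> carrier_vec n" and norm: "\<psi> \<bullet>c \<psi> = 1"
  shows "pure_state \<psi> * pure_state \<psi> = pure_state \<psi>"
proof (rule eq_matI)
  fix i j assume "i < dim_row (pure_state \<psi>)" "j < dim_col (pure_state \<psi>)"
  then have ij: "i < n" "j < n" using \<psi> by (auto simp: pure_state_def)
  have "(pure_state \<psi> * pure_state \<psi>) $$ (i, j) = \<psi> $ i * (\<psi> \<bullet>c \<psi>) * cnj (\<psi> $ j)"
    using ij \<psi> by (simp add: pure_state_def scalar_prod_def sum_distrib_left sum_distrib_right ac_simps)
  then show "(pure_state \<psi> * pure_state \<psi>) $$ (i, j) = pure_state \<psi> $$ (i, j)"
    using ij \<psi> norm by (simp add: pure_state_def)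
qed (auto simp: pure_state_def)

text \<open>The range of an idempotent is the set of its fixed vectors. Hence the projector onto the
  eigenspace of 1 is the pure state itself.\<close>

lemma pure_state_orth_projector:
  assumes \<psi>: "\<psi> \<in> carrier_vec n" and norm: "\<psi> \<bullet>c \<psi> = 1"
  shows "is_orth_projector n (eigenspace (pure_state \<psi>) 1) (pure_state \<psi>)"
proof -
  let ?P = "pure_state \<psi>"
  have P: "?P \<in> carrier_mat n n" by (rule pure_state_carrier[OF \<psi>])
  have "mat_adjoint ?P = ?P"
    by (rule eq_matI) (auto simp: pure_state_def)
  moreover have "(\<lambda>v. ?P *\<^sub>v v) ` carrier_vec n = eigenspace ?P 1"
  proof (intro equalityI subsetI)
    fix v assume "v \<in> (\<lambda>v. ?P *\<^sub>v v) ` carrier_vec n"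
    then obtain w where w: "w \<in> carrier_vec n" "v = ?P *\<^sub>v w" by auto
    then have "?P *\<^sub>v v = v"
      using assoc_mult_mat_vec[OF P P w(1)] by (simp add: pure_state_idem[OF \<psi> norm])
    then show "v \<in> eigenspace ?P 1" using w P by (auto simp: eigenspace_iff[OF P])
  next
    fix v assume "v \<in> eigenspace ?P 1"
    then have "v \<in> carrier_vec n" "v = ?P *\<^sub>v v" by (auto simp: eigenspace_iff[OF P])
    then show "v \<in> (\<lambda>v. ?P *\<^sub>v v) ` carrier_vec n" by blast
  qed
  ultimately show ?thesis using P pure_state_idem[OF \<psi> norm] by (simp add: is_orth_projector_def)
qed

lemma density_matrix_pure_state:
  assumes \<psi>: "\<psi> \<in> carrier_vec n" and norm: "\<psi> \<bullet>c \<psi> = 1"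
  shows "density_matrix n (pure_state \<psi>)"
  using pos_semidef_orth_projector[OF pure_state_orth_projector[OF assms]] trace_pure_state[OF \<psi>] norm
  by (simp add: density_matrix_def pos_semidef_def)

text \<open>Idempotence forces \<open>e = e * e\<close>. The second claim is only an implication
  because 0 is not an eigenvalue when the space has dimension 1.\<close>

lemma pure_state_eigenvalues:
  assumes \<psi>: "\<psi> \<in> carrier_vec n" and norm: "\<psi> \<bullet>c \<psi> = 1"
  shows "eigenvalue (pure_state \<psi>) 1" and "eigenvalue (pure_state \<psi>) e \<Longrightarrow> e = 0 \<or> e = 1"
proof -
  let ?P = "pure_state \<psi>"
  have P: "?P \<in> carrier_mat n n" by (rule pure_state_carrier[OF \<psi>])
  have "\<psi> \<noteq> 0\<^sub>v n" using norm by auto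
  then show "eigenvalue ?P 1"
    unfolding eigenvalue_def eigenvector_def using \<psi> P norm
    by (intro exI[of _ \<psi>]) (auto simp: pure_state_mult_vec[OF \<psi> \<psi>])
  assume "eigenvalue ?P e"
  then obtain v where v: "v \<in> carrier_vec n" "v \<noteq> 0\<^sub>v n" "?P *\<^sub>v v = e \<cdot>\<^sub>v v"
    using P by (auto simp: eigenvalue_def eigenvector_def)
  have "e \<cdot>\<^sub>v v = ?P *\<^sub>v (?P *\<^sub>v v)"
    using assoc_mult_mat_vec[OF P P v(1)] by (simp add: pure_state_idem[OF \<psi> norm] v(3))
  also have "\<dots> = e \<cdot>\<^sub>v (e \<cdot>\<^sub>v v)" using P v by (simp add: mult_mat_vec)
  finally have eq: "e \<cdot>\<^sub>v v = e \<cdot>\<^sub>v (e \<cdot>\<^sub>v v)" .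
  obtain i where i: "i < n" "v $ i \<noteq> 0" using v by (metis carrier_vecD eq_vecI index_zero_vec)
  from arg_cong[OF eq, of "\<lambda>w. w $ i"] have "e * v $ i = e * (e * v $ i)"
    using i v(1) by simp
  then show "e = 0 \<or> e = 1" using i by auto
qed

lemma M_marginal_pure_state:
  assumes \<psi>: "\<psi> \<in> carrier_vec n" and norm: "\<psi> \<bullet>c \<psi> = 1"
    and ptr: "positive_trace_preserving n N ptr" and N: "N \<ge> 1"
    and flat: "ptr (pure_state \<psi>) = mat_diag N (\<lambda>i. complex_of_real (1 / real N))"
  shows "M_marginal ptr (pure_state \<psi>) = log 2 (real N)"
proof -
  let ?P = "pure_state \<psi>"
  let ?f = "\<lambda>\<eta>. \<Sum>x \<in># nonzero_eigenvalues (ptr (complex_of_real \<eta> \<cdot>\<^sub>m eigenprojector ?P (complex_of_real \<eta>))).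
            \<bar>x - nim \<eta> x\<bar> * log 2 (x / (\<eta> * real (eigenspace_dim ?P (complex_of_real \<eta>))))"
  let ?S = "{\<eta>. eigenvalue ?P (complex_of_real \<eta>)}"
  note density = density_matrix_pure_state[OF \<psi> norm]
  have P: "?P \<in> carrier_mat n n" by (rule pure_state_carrier[OF \<psi>])
  have proj: "eigenprojector ?P 1 = ?P"
    by (rule eigenprojector_eqI[OF pure_state_orth_projector[OF \<psi> norm]]) (use P in auto)
  have "of_nat (eigenspace_dim ?P 1) = (1 :: complex)"
    using density_matrix_eigenspaces(5)[OF density, of 1] trace_pure_state[OF \<psi>] norm by (simp add: proj)
  then have dim: "eigenspace_dim ?P 1 = 1" by simp
  \<comment> \<open>The marginal of the zero block has nonnegative eigenvalues summing to 0, so no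
    nonzero ones; this holds whether or not 0 is an eigenvalue of the state.\<close>
  have f0: "?f 0 = 0"
  proof -
    obtain x where x: "\<And>i. i < N \<Longrightarrow> 0 \<le> x i"
      "(\<Sum>i<N. x i) = 0 * real (eigenspace_dim ?P (complex_of_real 0))"
      and ev: "nonzero_eigenvalues (ptr (complex_of_real 0 \<cdot>\<^sub>m eigenprojector ?P (complex_of_real 0)))
        = image_mset x (mset_set {i. i < N \<and> x i \<noteq> 0})"
      using density_matrix_marginal_spectrum[OF density ptr order.refl] by blast
    have "\<forall>i<N. x i = 0" using x sum_nonneg_eq_0_iff[of "{..<N}" x] by auto
    then have empty: "{i. i < N \<and> x i \<noteq> 0} = {}" by auto
    show ?thesis unfolding ev empty by simp
  qed
  have f1: "?f 1 = - log 2 (real N)"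
  proof -
    \<comment> \<open>The flat marginal is already diagonal, so the identity serves as the
      unitary.\<close>
    interpret unitary_diagonalization N "ptr ?P" "1\<^sub>m N" "\<lambda>i. complex_of_real (1 / real N)"
      by unfold_locales (auto simp: flat left_mult_one_mat[OF mat_diag_dim] right_mult_one_mat[OF mat_diag_dim])
    have "nonzero_eigenvalues (ptr ?P) = image_mset (\<lambda>i. 1 / real N) (mset_set {..<N})"
      using nonzero_eigenvalues_eq[of "\<lambda>i. 1 / real N"] N by (simp add: lessThan_def)
    moreover have "(1::complex) \<cdot>\<^sub>m ?P = ?P" by (rule eq_matI) auto
    ultimately have "?f 1 = N * (\<bar>1 / real N - nim 1 (1 / real N)\<bar> * log 2 (1 / real N))"
      by (simp add: proj dim multiset.map_comp comp_def)
    also have "\<dots> = - log 2 (real N)"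
    proof (cases "N = 1")
      case False
      with N have N2: "N \<ge> 2" by simp
      then have "\<lfloor>1 / real N\<rfloor> = 0" "\<lceil>1 / real N\<rceil> = 1"
        by (auto simp: floor_eq_iff ceiling_eq_iff)
      \<comment> \<open>This puts \<open>1 / real N\<close> at least as close to 0 as to 1. For
        \<open>N = 2\<close> there is a tie, which \<open>nim\<close> rounds down.\<close>
      moreover have "1 / real N \<le> 1 / 2" using N2 by (intro divide_left_mono) auto
      ultimately have "nim 1 (1 / real N) = 0" by (simp add: nim_def)
      then show ?thesis using N by (simp add: log_divide)
    qed simp
    finally show ?thesis .
  qed
  have "(\<Sum>\<eta>\<in>?S. ?f \<eta>) = (\<Sum>\<eta>\<in>{1}. ?f \<eta>)"
  proof (rule sum.mono_neutral_right)
    show "finite ?S" by (rule density_matrix_eigenspaces(1)[OF density])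
    show "{1} \<subseteq> ?S" using pure_state_eigenvalues(1)[OF \<psi> norm] by simp
    show "\<forall>\<eta>\<in>?S - {1}. ?f \<eta> = 0"
    proof
      fix \<eta> assume "\<eta> \<in> ?S - {1}"
      then have "\<eta> = 0" using pure_state_eigenvalues(2)[OF \<psi> norm, of "complex_of_real \<eta>"] by auto
      then show "?f \<eta> = 0" using f0 by (simp only:)
    qed
  qed
  then show ?thesis unfolding M_marginal_def using f1 by simp
qed

section \<open>Partial traces and the Bell state\<close>

lemma block_index_less:
  fixes i k :: nat
  assumes "i < m" "k < l"
  shows "i * l + k < m * l"
proof -
  have "i * l + k < Suc i * l" using assms by simp
  also have "\<dots> \<le> m * l" using assms by (intro mult_right_mono) auto
  finally show ?thesis .
qed

lemma sum_lessThan_mult: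
  fixes f :: "nat \<Rightarrow> 'a::comm_monoid_add"
  shows "(\<Sum>a<m * l. f a) = (\<Sum>i<m. \<Sum>k<l. f (i * l + k))"
  by (simp add: sum.nat_group[symmetric] sum.atLeastLessThan_shift_0 atLeast0LessThan)

lemma quadratic_form_sum:
  fixes A :: "complex mat"
  assumes "A \<in> carrier_mat n n" "v \<in> carrier_vec n"
  shows "(A *\<^sub>v v) \<bullet>c v = (\<Sum>i<n. \<Sum>j<n. A $$ (i, j) * v $ j * cnj (v $ i))"
  using assms by (auto simp: scalar_prod_def sum_distrib_right atLeast0LessThan intro!: sum.cong)

lemma trace_ptrace_B: "mat_trace dA (ptrace_B dA dB X) = mat_trace (dA * dB) X"
  by (simp add: sum_lessThan_mult ptrace_B_def)

lemma trace_ptrace_A: "mat_trace dB (ptrace_A dA dB X) = mat_trace (dA * dB) X"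
  unfolding sum_lessThan_mult by (subst sum.swap) (simp add: ptrace_A_def)

text \<open>With \<open>w k\<close> the product of \<open>v\<close> and the \<open>k\<close>-th
  standard basis vector of the second factor, the form of the partial trace at \<open>v\<close> is
  the sum over \<open>k\<close> of the form of \<open>X\<close> at \<open>w k\<close>, each term
  being nonnegative.\<close>

lemma positive_trace_preserving_ptrace_B:
  "positive_trace_preserving (dA * dB) dA (ptrace_B dA dB)"
  unfolding positive_trace_preserving_def
proof (intro allI impI conjI trace_ptrace_B)
  fix X assume "pos_semidef (dA * dB) X"
  then have X: "X \<in> carrier_mat (dA * dB) (dA * dB)" and herm: "mat_adjoint X = X"
    and pos: "\<And>v. v \<in> carrier_vec (dA * dB) \<Longrightarrow> 0 \<le> Re ((X *\<^sub>v v) \<bullet>c v)"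
    by (auto simp: pos_semidef_def)
  let ?Y = "ptrace_B dA dB X"
  have Y: "?Y \<in> carrier_mat dA dA" by (simp add: ptrace_B_def)
  have "mat_adjoint ?Y = ?Y"
    by (rule eq_matI) (auto simp: ptrace_B_def hermitian_index[OF X herm] block_index_less)
  moreover have "0 \<le> Re ((?Y *\<^sub>v v) \<bullet>c v)" if v: "v \<in> carrier_vec dA" for v
  proof -
    define w where "w k = vec (dA * dB) (\<lambda>a. if a mod dB = k then v $ (a div dB) else 0)" for k
    have w: "w k \<in> carrier_vec (dA * dB)" for k by (simp add: w_def)
    have wi: "w k $ (i * dB + l) = (if l = k then v $ i else 0)" if "i < dA" "l < dB" for i l k
      using that by (simp add: w_def block_index_less)
    have "(?Y *\<^sub>v v) \<bullet>c v =
        (\<Sum>i<dA. \<Sum>j<dA. \<Sum>k<dB. X $$ (i * dB + k, j * dB + k) * v $ j * cnj (v $ i))"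
      unfolding quadratic_form_sum[OF Y v] by (simp add: ptrace_B_def sum_distrib_right)
    also have "\<dots> = (\<Sum>i<dA. \<Sum>k<dB. \<Sum>j<dA. X $$ (i * dB + k, j * dB + k) * v $ j * cnj (v $ i))"
      by (rule sum.cong[OF refl], rule sum.swap)
    also have "\<dots> = (\<Sum>k<dB. \<Sum>i<dA. \<Sum>j<dA. X $$ (i * dB + k, j * dB + k) * v $ j * cnj (v $ i))"
      by (rule sum.swap)
    also have "\<dots> = (\<Sum>k<dB. (X *\<^sub>v w k) \<bullet>c w k)"
    proof (rule sum.cong[OF refl])
      fix k assume k: "k \<in> {..<dB}"
      have "(X *\<^sub>v w k) \<bullet>c w k = (\<Sum>i<dA. \<Sum>l<dB. \<Sum>j<dA. \<Sum>m<dB.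
          if l = k then (if m = k then X $$ (i * dB + l, j * dB + m) * v $ j * cnj (v $ i) else 0) else 0)"
        unfolding quadratic_form_sum[OF X w] sum_lessThan_mult
        by (intro sum.cong refl) (simp add: wi)
      also have "\<dots> = (\<Sum>i<dA. \<Sum>l<dB. if l = k then
          (\<Sum>j<dA. X $$ (i * dB + l, j * dB + k) * v $ j * cnj (v $ i)) else 0)"
        using k by (intro sum.cong refl) auto
      also have "\<dots> = (\<Sum>i<dA. \<Sum>j<dA. X $$ (i * dB + k, j * dB + k) * v $ j * cnj (v $ i))"
        by (rule sum.cong[OF refl]) (use k in simp)
      finally show "(\<Sum>i<dA. \<Sum>j<dA. X $$ (i * dB + k, j * dB + k) * v $ j * cnj (v $ i)) =
          (X *\<^sub>v w k) \<bullet>c w k" ..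
    qed
    finally show ?thesis by (simp only: Re_sum) (intro sum_nonneg pos w)
  qed
  ultimately show "pos_semidef dA ?Y" using Y by (simp add: pos_semidef_def)
qed

lemma positive_trace_preserving_ptrace_A:
  "positive_trace_preserving (dA * dB) dB (ptrace_A dA dB)"
  unfolding positive_trace_preserving_def
proof (intro allI impI conjI trace_ptrace_A)
  fix X assume "pos_semidef (dA * dB) X"
  then have X: "X \<in> carrier_mat (dA * dB) (dA * dB)" and herm: "mat_adjoint X = X"
    and pos: "\<And>v. v \<in> carrier_vec (dA * dB) \<Longrightarrow> 0 \<le> Re ((X *\<^sub>v v) \<bullet>c v)"
    by (auto simp: pos_semidef_def)
  let ?Y = "ptrace_A dA dB X"
  have Y: "?Y \<in> carrier_mat dB dB" by (simp add: ptrace_A_def)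
  have "mat_adjoint ?Y = ?Y"
    by (rule eq_matI) (auto simp: ptrace_A_def hermitian_index[OF X herm] block_index_less)
  moreover have "0 \<le> Re ((?Y *\<^sub>v v) \<bullet>c v)" if v: "v \<in> carrier_vec dB" for v
  proof -
    \<comment> \<open>Here the standard basis vector sits in the first factor: \<open>w i\<close> is
      the product of the \<open>i\<close>-th one with \<open>v\<close>.\<close>
    define w where "w i = vec (dA * dB) (\<lambda>a. if a div dB = i then v $ (a mod dB) else 0)" for i
    have w: "w i \<in> carrier_vec (dA * dB)" for i by (simp add: w_def)
    have wi: "w i $ (j * dB + l) = (if j = i then v $ l else 0)" if "j < dA" "l < dB" for i j l
      using that by (simp add: w_def block_index_less)
    have "(?Y *\<^sub>v v) \<bullet>c v =
        (\<Sum>k<dB. \<Sum>l<dB. \<Sum>i<dA. X $$ (i * dB + k, i * dB + l) * v $ l * cnj (v $ k))"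
      unfolding quadratic_form_sum[OF Y v] by (simp add: ptrace_A_def sum_distrib_right)
    also have "\<dots> = (\<Sum>k<dB. \<Sum>i<dA. \<Sum>l<dB. X $$ (i * dB + k, i * dB + l) * v $ l * cnj (v $ k))"
      by (rule sum.cong[OF refl], rule sum.swap)
    also have "\<dots> = (\<Sum>i<dA. \<Sum>k<dB. \<Sum>l<dB. X $$ (i * dB + k, i * dB + l) * v $ l * cnj (v $ k))"
      by (rule sum.swap)
    also have "\<dots> = (\<Sum>i<dA. (X *\<^sub>v w i) \<bullet>c w i)"
    proof (rule sum.cong[OF refl])
      fix i assume i: "i \<in> {..<dA}"
      have "(X *\<^sub>v w i) \<bullet>c w i = (\<Sum>j<dA. \<Sum>k<dB. \<Sum>m<dA. \<Sum>l<dB.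
          X $$ (j * dB + k, m * dB + l) * (if m = i then v $ l else 0) * cnj (if j = i then v $ k else 0))"
        unfolding quadratic_form_sum[OF X w] sum_lessThan_mult
        by (intro sum.cong refl) (simp add: wi)
      also have "\<dots> = (\<Sum>j<dA. \<Sum>k<dB. \<Sum>m<dA. if m = i then (\<Sum>l<dB.
          X $$ (j * dB + k, m * dB + l) * v $ l * cnj (if j = i then v $ k else 0)) else 0)"
        by (intro sum.cong refl) auto
      also have "\<dots> = (\<Sum>j<dA. if j = i then
          (\<Sum>k<dB. \<Sum>l<dB. X $$ (j * dB + k, i * dB + l) * v $ l * cnj (v $ k)) else 0)"
        using i by (intro sum.cong refl) auto
      also have "\<dots> = (\<Sum>k<dB. \<Sum>l<dB. X $$ (i * dB + k, i * dB + l) * v $ l * cnj (v $ k))"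
        using i by auto
      finally show "(\<Sum>k<dB. \<Sum>l<dB. X $$ (i * dB + k, i * dB + l) * v $ l * cnj (v $ k)) =
          (X *\<^sub>v w i) \<bullet>c w i" ..
    qed
    finally show ?thesis by (simp only: Re_sum) (intro sum_nonneg pos w)
  qed
  ultimately show "pos_semidef dB ?Y" using Y by (simp add: pos_semidef_def)
qed

text \<open>For the matrix \<open>U\<close> with columns \<open>a m\<close>, orthonormality says
  that \<open>mat_adjoint U\<close> is a left inverse. For a square matrix it is then a right
  inverse too, and the entries of that product are the sums in question.\<close>

lemma orthonormal_basis_completeness:
  assumes a: "orthonormal_basis N a" and ij: "i < N" "j < N"
  shows "(\<Sum>m<N. a m $ i * cnj (a m $ j)) = (if i = j then 1 else 0)"
proof -
  define U where "U = mat N N (\<lambda>(i, m). a m $ i)"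
  have U: "U \<in> carrier_mat N N" by (simp add: U_def)
  have ca: "a m \<in> carrier_vec N" if "m < N" for m using a that by (simp add: orthonormal_basis_def)
  have "mat_adjoint U * U = 1\<^sub>m N"
  proof (rule eq_matI)
    fix k l assume "k < dim_row (1\<^sub>m N :: complex mat)" "l < dim_col (1\<^sub>m N :: complex mat)"
    then have kl: "k < N" "l < N" by auto
    have "(mat_adjoint U * U) $$ (k, l) = a l \<bullet>c a k"
      using kl ca[OF kl(1)] ca[OF kl(2)] by (simp add: U_def scalar_prod_def mult.commute)
    then show "(mat_adjoint U * U) $$ (k, l) = 1\<^sub>m N $$ (k, l)"
      using a kl by (auto simp: orthonormal_basis_def)
  qed (use U in auto)
  then have "U * mat_adjoint U = 1\<^sub>m N" by (rule unitary_right_inverse[OF U])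
  then have "(U * mat_adjoint U) $$ (i, j) = (if i = j then 1 else 0)" using ij by simp
  then show ?thesis using ij by (simp add: U_def scalar_prod_def atLeast0LessThan)
qed

text \<open>Up to the factor 1/sqrt(N), the inner sums are the coordinates of the Bell vector,
  arranged as an N by N matrix; the claim is that its rows are orthonormal. Summing over
  \<open>k\<close> uses orthonormality of \<open>b\<close>, and the remaining sum is the
  completeness relation of \<open>a\<close>.\<close>

lemma orthonormal_tensor_sum:
  assumes a: "orthonormal_basis N a" and b: "orthonormal_basis N b" and ij: "i < N" "j < N"
  shows "(\<Sum>k<N. (\<Sum>m<N. a m $ i * b m $ k) * cnj (\<Sum>m<N. a m $ j * b m $ k)) = (if i = j then 1 else 0)"
proof -
  have cb: "b m \<in> carrier_vec N" if "m < N" for m using b that by (simp add: orthonormal_basis_def)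
  have inner: "b m \<bullet>c b l = (\<Sum>k<N. b m $ k * cnj (b l $ k))" if "m < N" "l < N" for m l
    using cb[OF that(1)] cb[OF that(2)] by (simp add: scalar_prod_def atLeast0LessThan)
  have "(\<Sum>k<N. (\<Sum>m<N. a m $ i * b m $ k) * cnj (\<Sum>m<N. a m $ j * b m $ k)) =
      (\<Sum>k<N. \<Sum>m<N. \<Sum>l<N. a m $ i * cnj (a l $ j) * (b m $ k * cnj (b l $ k)))"
    by (simp add: sum_product ac_simps)
  also have "\<dots> = (\<Sum>m<N. \<Sum>k<N. \<Sum>l<N. a m $ i * cnj (a l $ j) * (b m $ k * cnj (b l $ k)))"
    by (rule sum.swap)
  also have "\<dots> = (\<Sum>m<N. \<Sum>l<N. \<Sum>k<N. a m $ i * cnj (a l $ j) * (b m $ k * cnj (b l $ k)))"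
    by (rule sum.cong[OF refl], rule sum.swap)
  also have "\<dots> = (\<Sum>m<N. \<Sum>l<N. a m $ i * cnj (a l $ j) * (b m \<bullet>c b l))"
    by (intro sum.cong refl) (simp add: inner sum_distrib_left)
  also have "\<dots> = (\<Sum>m<N. \<Sum>l<N. if m = l then a m $ i * cnj (a l $ j) else 0)"
    using b by (intro sum.cong refl) (auto simp: orthonormal_basis_def)
  also have "\<dots> = (\<Sum>m<N. a m $ i * cnj (a m $ j))" by simp
  finally show ?thesis using orthonormal_basis_completeness[OF a ij] by simp
qed

lemma bell_vec_carrier: "bell_vec N a b \<in> carrier_vec (N * N)"
  if "orthonormal_basis N a" "orthonormal_basis N b"
proof -
  have "tensor_vec (a i) (b i) \<in> carrier_vec (N * N)" if "i < N" for i
    using \<open>orthonormal_basis N a\<close> \<open>orthonormal_basis N b\<close> that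
    by (auto simp: orthonormal_basis_def tensor_vec_def)
  then show ?thesis unfolding bell_vec_def by (auto intro!: finsum_vec_closed)
qed

lemma bell_vec_index:
  assumes a: "orthonormal_basis N a" and b: "orthonormal_basis N b" and ik: "i < N" "k < N"
  shows "bell_vec N a b $ (i * N + k) =
    complex_of_real (1 / sqrt (real N)) * (\<Sum>m<N. a m $ i * b m $ k)"
proof -
  have lt: "i * N + k < N * N" using ik by (rule block_index_less)
  have ca: "a m \<in> carrier_vec N" "b m \<in> carrier_vec N" if "m < N" for m
    using a b that by (auto simp: orthonormal_basis_def)
  have T: "(\<lambda>m. tensor_vec (a m) (b m)) \<in> {..<N} \<rightarrow> carrier_vec (N * N)"
    using ca by (fastforce simp: tensor_vec_def)
  have "finsum_vec TYPE(complex) (N * N) (\<lambda>m. tensor_vec (a m) (b m)) {..<N} $ (i * N + k)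
      = (\<Sum>m<N. tensor_vec (a m) (b m) $ (i * N + k))"
    by (rule index_finsum_vec[OF _ lt T]) simp
  also have "\<dots> = (\<Sum>m<N. a m $ i * b m $ k)"
  proof (rule sum.cong[OF refl])
    fix m assume "m \<in> {..<N}"
    then have "dim_vec (a m) = N" "dim_vec (b m) = N" using ca[of m] by auto
    then show "tensor_vec (a m) (b m) $ (i * N + k) = a m $ i * b m $ k"
      using ik lt by (simp add: tensor_vec_def)
  qed
  finally show ?thesis
    using lt finsum_vec_closed[OF T] by (simp add: bell_vec_def)
qed

lemma ptrace_bell:
  assumes a: "orthonormal_basis N a" and b: "orthonormal_basis N b" and N: "N \<ge> 1"
  shows "ptrace_B N N (pure_state (bell_vec N a b)) = mat_diag N (\<lambda>i. complex_of_real (1 / real N))"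
    and "ptrace_A N N (pure_state (bell_vec N a b)) = mat_diag N (\<lambda>i. complex_of_real (1 / real N))"
proof -
  let ?\<psi> = "bell_vec N a b"
  have dim: "dim_vec ?\<psi> = N * N" using bell_vec_carrier[OF a b] by simp
  have sq: "complex_of_real (1 / sqrt (real N)) * u * cnj (complex_of_real (1 / sqrt (real N)) * v)
      = complex_of_real (1 / real N) * (u * cnj v)" for u v
  proof -
    have "complex_of_real (1 / sqrt (real N)) * u * cnj (complex_of_real (1 / sqrt (real N)) * v)
      = complex_of_real (1 / sqrt (real N) * (1 / sqrt (real N))) * (u * cnj v)"
      by (simp only: complex_cnj_mult complex_cnj_complex_of_real of_real_mult ac_simps)
    also have "1 / sqrt (real N) * (1 / sqrt (real N)) = 1 / real N"
      by simp
    finally show ?thesis .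
  qed
  have entry: "pure_state ?\<psi> $$ (i * N + k, j * N + l) = complex_of_real (1 / real N) *
      ((\<Sum>m<N. a m $ i * b m $ k) * cnj (\<Sum>m<N. a m $ j * b m $ l))"
    if "i < N" "j < N" "k < N" "l < N" for i j k l
  proof -
    have "pure_state ?\<psi> $$ (i * N + k, j * N + l) = ?\<psi> $ (i * N + k) * cnj (?\<psi> $ (j * N + l))"
      using that by (simp add: pure_state_def dim block_index_less)
    then show ?thesis unfolding bell_vec_index[OF a b that(1,3)] bell_vec_index[OF a b that(2,4)] sq .
  qed
  show "ptrace_B N N (pure_state ?\<psi>) = mat_diag N (\<lambda>i. complex_of_real (1 / real N))"
  proof (rule eq_matI)
    fix i j assume "i < dim_row (mat_diag N (\<lambda>i. complex_of_real (1 / real N)))"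
      "j < dim_col (mat_diag N (\<lambda>i. complex_of_real (1 / real N)))"
    then have ij: "i < N" "j < N" by (auto simp: mat_diag_def)
    have "ptrace_B N N (pure_state ?\<psi>) $$ (i, j) = complex_of_real (1 / real N) *
      (\<Sum>k<N. (\<Sum>m<N. a m $ i * b m $ k) * cnj (\<Sum>m<N. a m $ j * b m $ k))"
      unfolding sum_distrib_left using ij entry by (simp add: ptrace_B_def)
    then show "ptrace_B N N (pure_state ?\<psi>) $$ (i, j) = mat_diag N (\<lambda>i. complex_of_real (1 / real N)) $$ (i, j)"
      unfolding orthonormal_tensor_sum[OF a b ij] using ij by (simp add: mat_diag_def)
  qed (auto simp: ptrace_B_def mat_diag_def)
  show "ptrace_A N N (pure_state ?\<psi>) = mat_diag N (\<lambda>i. complex_of_real (1 / real N))"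
  proof (rule eq_matI)
    fix k l assume "k < dim_row (mat_diag N (\<lambda>i. complex_of_real (1 / real N)))"
      "l < dim_col (mat_diag N (\<lambda>i. complex_of_real (1 / real N)))"
    then have kl: "k < N" "l < N" by (auto simp: mat_diag_def)
    \<comment> \<open>Tracing out the first factor pairs columns of the coordinate matrix instead of
      rows. Writing the products with \<open>b\<close> in front turns this into the row statement
      with \<open>a\<close> and \<open>b\<close> exchanged.\<close>
    have "ptrace_A N N (pure_state ?\<psi>) $$ (k, l) = complex_of_real (1 / real N) *
      (\<Sum>i<N. (\<Sum>m<N. b m $ k * a m $ i) * cnj (\<Sum>m<N. b m $ l * a m $ i))"
      unfolding sum_distrib_left using kl entry
      by (simp add: ptrace_A_def mult.commute[of "b _ $ _"])
    then show "ptrace_A N N (pure_state ?\<psi>) $$ (k, l) = mat_diag N (\<lambda>i. complex_of_real (1 / real N)) $$ (k, l)"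
      unfolding orthonormal_tensor_sum[OF b a kl] using kl by (simp add: mat_diag_def)
  qed (auto simp: ptrace_A_def mat_diag_def)
qed

theorem mainTheorem8:
  fixes N :: nat and a b :: "nat \<Rightarrow> complex vec"
  assumes "N \<ge> 1"
    and "orthonormal_basis N a"
    and "orthonormal_basis N b"
  shows "density_matrix (N * N) (pure_state (bell_vec N a b)) \<and>
    (\<forall>\<rho>. density_matrix (N * N) \<rho> \<longrightarrow> M_AB N N \<rho> \<le> M_AB N N (pure_state (bell_vec N a b)))"
proof -
  let ?\<psi> = "bell_vec N a b"
  have \<psi>: "?\<psi> \<in> carrier_vec (N * N)" by (rule bell_vec_carrier[OF assms(2,3)])
  note flat = ptrace_bell[OF assms(2,3,1)]
  \<comment> \<open>The normalization of the Bell vector comes for free from its marginal: the trace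
    of the pure state is the squared norm, and the flat marginal has trace \<open>N\<close> times
    \<open>1 / N\<close>.\<close>
  have "?\<psi> \<bullet>c ?\<psi> = mat_trace N (ptrace_B N N (pure_state ?\<psi>))"
    unfolding trace_ptrace_B trace_pure_state[OF \<psi>] ..
  also have "\<dots> = 1"
    unfolding flat using assms(1) by (simp add: mat_diag_def)
  finally have norm: "?\<psi> \<bullet>c ?\<psi> = 1" .
  note ptrs = positive_trace_preserving_ptrace_B[of N N] positive_trace_preserving_ptrace_A[of N N]
  have "M_AB N N (pure_state ?\<psi>) = log 2 (real N)"
    unfolding M_AB_def M_A_def M_B_def
    using M_marginal_pure_state[OF \<psi> norm ptrs(1) assms(1) flat(1)]
      M_marginal_pure_state[OF \<psi> norm ptrs(2) assms(1) flat(2)] by simp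
  moreover have "M_AB N N \<rho> \<le> log 2 (real N)" if "density_matrix (N * N) \<rho>" for \<rho>
    unfolding M_AB_def M_A_def M_B_def
    using M_marginal_le[OF that ptrs(1) assms(1)] M_marginal_le[OF that ptrs(2) assms(1)] by simp
  ultimately show ?thesis using density_matrix_pure_state[OF \<psi> norm] by simp
qed

end
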